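(* Let $N\ge 1$ be an integer and let $\Omega\subset\mathbb{R}^N$ be either the annulus $\{x\in\mathbb{R}^N : R_1<|x|<R_2\}$ with $0<R_1<R_2<+\infty$, or the ball $\{x\in\mathbb{R}^N : |x|<R_2\}$ with $0<R_2<+\infty$, in which case we set $R_1=0$. Let $s_0>0$ and let $f\in C^1([0,+\infty))$ satisfy $f(0)=f(s_0)=0$, $f(s)<0$ for $0<s<s_0$, and $f(s)>0$ for $s>s_0$. Assume that for some integer $k\ge 1$ it holds $f'(s_0)>\lambda_{k+1}^{\mathrm{rad}}$, where $\lambda_{k+1}^{\mathrm{rad}}$ is the $(k+1)$-th radial Neumann eigenvalue of $-\Delta$ in $\Omega$. Then there exist at least $2k$ distinct non-constant radial solutions $u_1,\ldots,u_{2k}$ to $$ \begin{cases} -\operatorname{div}\left(\dfrac{\nabla u}{\sqrt{1-|\nabla u|^2}}\right)=f(u) & \text{in }\Omega,\\ u>0 & \text{in }\Omega,\\ \partial_\nu u=0 & \text{on }\partial\Omega. \end{cases} $$ Moreover, writing $u_j(x)=u_j(r)$ with $r=|x|$: (i) $u_j(R_1)<s_0$ for every $j=1,\ldots,k$; (ii) $u_j(R_1)>s_0$ for every $j=k+1,\ldots,2k$; (iii) $u_j(r)-s_0$ and $u_{j+k}(r)-s_0$ have exactly $j$ zeros for $r\in(R_1,R_2)$, for every $j=1,\ldots,k$.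
   Context: Here $\nu$ is the outer unit normal of $\partial\Omega$. Solutions are radial functions of class $C^2(\overline{\Omega})$ (with $|\nabla u|<1$, so that the equation makes sense), and a radial function $u(x)$ is identified with the function $u(r)$, $r=|x|$. Equivalently, in radial form, $\left(r^{N-1}\frac{u'}{\sqrt{1-(u')^2}}\right)'+r^{N-1}f(u)=0$ and $u>0$ in $(R_1,R_2)$, with $u'(R_1)=u'(R_2)=0$. The radial Neumann eigenvalues $\lambda_k^{\mathrm{rad}}$ are the values $\lambda$ for which the problem $-(r^{N-1}u')'=\lambda r^{N-1}u$ in $(R_1,R_2)$, $u'(R_1)=u'(R_2)=0$, has a nontrivial solution. It is known that they are all simple and form an increasing sequence $0=\lambda_1^{\mathrm{rad}}<\lambda_2^{\mathrm{rad}}<\cdots<\lambda_k^{\mathrm{rad}}<\cdots\to+\infty$. *)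

theory Defs
  imports "HOL-Analysis.Analysis"
begin

definition gradient :: "('a::euclidean_space \<Rightarrow> real) \<Rightarrow> 'a \<Rightarrow> 'a" where
  "gradient u x = (\<Sum>b\<in>Basis. frechet_derivative u (at x) b *\<^sub>R b)"

definition divergence :: "('a::euclidean_space \<Rightarrow> 'a) \<Rightarrow> 'a \<Rightarrow> real" where
  "divergence F x = (\<Sum>b\<in>Basis. frechet_derivative F (at x) b \<bullet> b)"

(* u is of class C^2 on the closure of the open set \<Omega>: the derivatives of order at most 2
   exist in \<Omega> and extend continuously to the closure. G and H are the extended gradient
   and the extended second derivative. *)
definition C2_closure :: "'a::euclidean_space set \<Rightarrow> ('a \<Rightarrow> real) \<Rightarrow> bool" where
  "C2_closure \<Omega> u \<longleftrightarrow>
     (\<exists>(G :: 'a \<Rightarrow> 'a) (H :: 'a \<Rightarrow> 'a \<Rightarrow>\<^sub>L 'a).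
        continuous_on (closure \<Omega>) u \<and>
        continuous_on (closure \<Omega>) G \<and>
        continuous_on (closure \<Omega>) H \<and>
        (\<forall>x\<in>\<Omega>. GDERIV u x :> G x) \<and>
        (\<forall>x\<in>\<Omega>. (G has_derivative blinfun_apply (H x)) (at x)))"

(* On the boundary of the annulus R1 < |x| < R2 the normal points towards the origin on
   the inner sphere. For the ball (R1 = 0) no boundary point has norm R1. *)
definition outer_normal :: "real \<Rightarrow> 'a::euclidean_space \<Rightarrow> 'a" where
  "outer_normal R1 x = (if norm x = R1 then - sgn x else sgn x)"

(* Points x + t * \<nu> x with x on the boundary and t < 0 small lie inside \<Omega>, so the normal
   derivative is the left derivative at t = 0 along the outer normal \<nu>. *)
definition neumann_solution ::
  "'a::euclidean_space set \<Rightarrow> ('a \<Rightarrow> 'a) \<Rightarrow> (real \<Rightarrow> real) \<Rightarrow> ('a \<Rightarrow> real) \<Rightarrow> bool" where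
  "neumann_solution \<Omega> \<nu> f u \<longleftrightarrow>
     C2_closure \<Omega> u \<and>
     (\<forall>x\<in>\<Omega>. norm (gradient u x) < 1) \<and>
     (\<forall>x\<in>\<Omega>. - divergence (\<lambda>y. gradient u y /\<^sub>R sqrt (1 - (norm (gradient u y))\<^sup>2)) x = f (u x)) \<and>
     (\<forall>x\<in>\<Omega>. u x > 0) \<and>
     (\<forall>x\<in>frontier \<Omega>. ((\<lambda>t. u (x + t *\<^sub>R \<nu> x)) has_real_derivative 0) (at_left 0))"

(* The derivatives of w at the end points are one-sided. For R1 = 0 and N \<ge> 2 the
   differentiability of w at 0 is what excludes solutions that are singular at the origin. *)
definition radial_neumann_eigenvalue :: "nat \<Rightarrow> real \<Rightarrow> real \<Rightarrow> real \<Rightarrow> bool" where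
  "radial_neumann_eigenvalue N R1 R2 lam \<longleftrightarrow>
     (\<exists>w w' :: real \<Rightarrow> real.
        (\<forall>r\<in>{R1..R2}. (w has_real_derivative w' r) (at r within {R1..R2})) \<and>
        continuous_on {R1..R2} w' \<and>
        (\<forall>r\<in>{R1<..<R2}. ((\<lambda>s. s ^ (N - 1) * w' s) has_real_derivative
                              - (lam * r ^ (N - 1) * w r)) (at r)) \<and>
        w' R1 = 0 \<and> w' R2 = 0 \<and>
        (\<exists>r\<in>{R1..R2}. w r \<noteq> 0))"

(* lam is the k-th term (k \<ge> 1) of the increasing enumeration of the eigenvalues.
   Multiplicities play no role since all of them are simple. *)
definition is_kth_radial_neumann_eigenvalue ::
  "nat \<Rightarrow> real \<Rightarrow> real \<Rightarrow> nat \<Rightarrow> real \<Rightarrow> bool" where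
  "is_kth_radial_neumann_eigenvalue N R1 R2 k lam \<longleftrightarrow>
     radial_neumann_eigenvalue N R1 R2 lam \<and>
     finite {mu. radial_neumann_eigenvalue N R1 R2 mu \<and> mu < lam} \<and>
     Suc (card {mu. radial_neumann_eigenvalue N R1 R2 mu \<and> mu < lam}) = k"

end

theory Submission
  imports Defs
begin

text \<open>Write the radial equation as a first order system for u and q = u'/sqrt(1-u'^2), namely
u' = q/sqrt(1+q^2), (r^(N-1)q)' = -r^(N-1)f(u), with q(R1) = 0. A Neumann solution is a
solution of this system with q(R2) = 0, and the free parameter is d = u(R1). The equation is
globally solvable, since |u'| < 1 and f matters only on a bounded interval.

In the phase plane with coordinates x = u - s0 and y = r^(N-1)q the curve starts on the axis
y = 0 and, as long as u > 0, turns clockwise around the origin, which it cannot reach.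
Let \<Theta>(d) be the angle through which it has turned at R2. The Neumann
condition at R2 says that \<Theta>(d) is a multiple j\<pi> of \<pi>; and then u - s0 has exactly j
zeros, one for each passage through the axis x = 0 (lemma \<open>card_flow_zeros\<close>). With f extended
by 0 to negative arguments, a solution with d > 0 that satisfies the Neumann condition is
automatically positive (lemma \<open>flow_positive\<close>).

So the task is to find, on either side of s0, values d with \<Theta>(d) = j\<pi> for 1 \<le> j \<le> k. The
function \<Theta> is continuous off s0. It is smaller than \<pi>/2 for d near 0 and for large d. Near
s0 the system is close to its linearization, which turns faster than the eigenvalue equation for
\<lambda> = \<lambda>(k+1) because f'(s0) > \<lambda>, so a Sturm comparison of angles (lemma
\<open>sturm_angle_comparison\<close>) bounds \<Theta>(d) from below by the angle of the eigenfunction. That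
angle is at least k\<pi>: the number of half turns of an eigenfunction is strictly increasing in the
eigenvalue, by the same comparison, and there are k eigenvalues below \<lambda> (lemma
\<open>kth_eigenvalue_half_turns\<close>). The intermediate value theorem yields the solutions (lemma
\<open>radial_solutions_exist\<close>).

The ball, where the system is singular at r = 0, is treated together with the annulus. The energy
estimates use (u,q), in which the singular term is a friction of favourable sign; the angle uses
(u, r^(N-1)q), in which there is no singular term. Back in \<Omega>, the regularity
of v(|x|) at the origin rests on q(r)/r \<longlongrightarrow> -f(u(0))/N (lemma \<open>radial_flow_deriv_origin\<close>).\<close>

section \<open>The radial system: uniqueness, dependence on data, existence\<close>

text \<open>The choice \<Phi>(q) = q/sqrt(1+q^2), G = f is the equation of the theorem with n = N-1: then
q = u'/sqrt(1-u'^2) and r^n q is the radial flux. The choice \<Phi>(q) = q, G(u) = \<lambda> u is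
the eigenvalue problem. Treating both at once lets the two be compared, and makes \<Phi> and G
free to be rescaled later.\<close>

definition radial_flow ::
  "nat \<Rightarrow> real \<Rightarrow> real \<Rightarrow> (real \<Rightarrow> real) \<Rightarrow> (real \<Rightarrow> real) \<Rightarrow> (real \<Rightarrow> real) \<Rightarrow> (real \<Rightarrow> real) \<Rightarrow> bool" where
  "radial_flow n R1 R2 \<Phi> G u q \<longleftrightarrow>
     (\<forall>r\<in>{R1..R2}. (u has_real_derivative \<Phi> (q r)) (at r within {R1..R2})) \<and>
     continuous_on {R1..R2} q \<and>
     (\<forall>r\<in>{R1<..<R2}. ((\<lambda>s. s ^ n * q s) has_real_derivative - (r ^ n * G (u r))) (at r)) \<and>
     q R1 = 0"

lemma gronwall_forward:
  fixes E E' :: "real \<Rightarrow> real"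
  assumes "a \<le> b" and cont: "continuous_on {a..b} E"
    and der: "\<And>r. a < r \<Longrightarrow> r < b \<Longrightarrow> (E has_real_derivative E' r) (at r)"
    and le: "\<And>r. a < r \<Longrightarrow> r < b \<Longrightarrow> E' r \<le> C * E r"
  shows "E b \<le> E a * exp (C * (b - a))"
proof -
  let ?F = "\<lambda>r. E r * exp (- (C * r))"
  have "?F b \<le> ?F a"
  proof (rule DERIV_nonpos_imp_decreasing_open[OF \<open>a \<le> b\<close>])
    fix x assume x: "a < x" "x < b"
    have "(?F has_real_derivative E' x * exp (- (C * x)) + E x * (exp (- (C * x)) * - C)) (at x)"
      by (auto intro!: derivative_eq_intros der x)
    moreover have "E' x * exp (- (C * x)) + E x * (exp (- (C * x)) * - C) = (E' x - C * E x) * exp (- (C * x))"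
      by (simp add: algebra_simps)
    moreover have "\<dots> \<le> 0"
      using le[OF x] by (intro mult_nonpos_nonneg) auto
    ultimately show "\<exists>y. (?F has_real_derivative y) (at x) \<and> y \<le> 0"
      by metis
  qed (auto intro!: continuous_intros cont)
  then have "?F b * exp (C * b) \<le> ?F a * exp (C * b)"
    by (intro mult_right_mono) auto
  then show ?thesis
    by (simp add: mult.assoc exp_add[symmetric] algebra_simps)
qed

lemma gronwall_backward:
  fixes E E' :: "real \<Rightarrow> real"
  assumes "a \<le> b" and cont: "continuous_on {a..b} E"
    and der: "\<And>r. a < r \<Longrightarrow> r < b \<Longrightarrow> (E has_real_derivative E' r) (at r)"
    and ge: "\<And>r. a < r \<Longrightarrow> r < b \<Longrightarrow> - (C * E r) \<le> E' r"
  shows "E a \<le> E b * exp (C * (b - a))"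
proof -
  have "(\<lambda>r. E (- r)) (- a) \<le> (\<lambda>r. E (- r)) (- b) * exp (C * (- a - (- b)))"
  proof (rule gronwall_forward[where E' = "\<lambda>r. - E' (- r)"])
    show "continuous_on {- b..- a} (\<lambda>r. E (- r))"
      by (rule continuous_on_compose2[OF cont]) (auto intro!: continuous_intros)
    fix r assume r: "- b < r" "r < - a"
    show "((\<lambda>r. E (- r)) has_real_derivative - E' (- r)) (at r)"
      using DERIV_chain2[OF der[of "- r"] DERIV_minus[OF DERIV_ident]] r by simp
    show "- E' (- r) \<le> C * E (- r)"
      using ge[of "- r"] r by simp
  qed (use \<open>a \<le> b\<close> in auto)
  then show ?thesis by (simp add: algebra_simps)
qed

lemma radial_flow_q_deriv:
  assumes fl: "radial_flow n R1 R2 \<Phi> G u q" and "0 \<le> R1" and r: "r \<in> {R1<..<R2}"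
  shows "(q has_real_derivative - G (u r) - n / r * q r) (at r)"
proof -
  have r0: "r > 0" using r \<open>0 \<le> R1\<close> by auto
  have "((\<lambda>s. s ^ n * q s) has_real_derivative - (r ^ n * G (u r))) (at r)"
    using fl r by (auto simp: radial_flow_def)
  moreover have "((\<lambda>s. s ^ n) has_real_derivative n * r ^ (n - 1)) (at r)"
    by (auto intro!: derivative_eq_intros)
  ultimately have "((\<lambda>s. s ^ n * q s / s ^ n) has_real_derivative
      (- (r ^ n * G (u r)) * r ^ n - r ^ n * q r * (n * r ^ (n - 1))) / (r ^ n * r ^ n)) (at r)"
    by (rule DERIV_divide) (use r0 in auto)
  moreover have "(- (r ^ n * G (u r)) * r ^ n - r ^ n * q r * (n * r ^ (n - 1))) / (r ^ n * r ^ n)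
      = - G (u r) - n / r * q r"
    using r0 by (cases n) (auto simp: field_simps)
  ultimately have "((\<lambda>s. s ^ n * q s / s ^ n) has_real_derivative - G (u r) - n / r * q r) (at r)"
    by simp
  then show ?thesis
    by (rule has_field_derivative_transform_within_open[of _ _ _ "{0<..}"]) (use r0 in auto)
qed

lemma radial_flow_u_cont:
  "radial_flow n R1 R2 \<Phi> G u q \<Longrightarrow> continuous_on {R1..R2} u"
  unfolding radial_flow_def by (intro DERIV_continuous_on) auto

lemma radial_flow_u_deriv:
  assumes "radial_flow n R1 R2 \<Phi> G u q" "r \<in> {R1<..<R2}"
  shows "(u has_real_derivative \<Phi> (q r)) (at r)"
proof -
  have "(u has_real_derivative \<Phi> (q r)) (at r within {R1..R2})"
    using assms by (auto simp: radial_flow_def)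
  moreover have "at r within {R1..R2} = at r"
    using assms(2) by (auto intro!: at_within_interior)
  ultimately show ?thesis by simp
qed

lemma two_mult_lipschitz_bound:
  fixes A B D :: real
  assumes "\<bar>D\<bar> \<le> K * \<bar>B\<bar>" "K \<ge> 0"
  shows "\<bar>2 * A * D\<bar> \<le> K * (A\<^sup>2 + B\<^sup>2)"
proof -
  have "\<bar>2 * A * D\<bar> = 2 * \<bar>A\<bar> * \<bar>D\<bar>" by (simp add: abs_mult)
  also have "\<dots> \<le> 2 * \<bar>A\<bar> * (K * \<bar>B\<bar>)" using assms by (intro mult_left_mono) auto
  also have "\<dots> = K * (2 * \<bar>A\<bar> * \<bar>B\<bar>)" by simp
  also have "\<dots> \<le> K * (A\<^sup>2 + B\<^sup>2)"
    using assms sum_squares_bound[of "\<bar>A\<bar>" "\<bar>B\<bar>"] by (intro mult_left_mono) auto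
  finally show ?thesis .
qed

text \<open>In the variables (u,q) the only singular term of the system is the friction -(n/r) q. In the
derivative of |u1-u2|^2 + |q1-q2|^2 it contributes -(2n/r)|q1-q2|^2 \<le> 0 and can be
discarded, so Gronwall's inequality gives a bound that does not see the origin.\<close>

lemma radial_flow_dependence:
  assumes fl1: "radial_flow n R1 R2 \<Phi> G u1 q1" and fl2: "radial_flow n R1 R2 \<Phi> G u2 q2"
    and R1: "0 \<le> R1"
    and K: "\<And>a b. \<bar>\<Phi> a - \<Phi> b\<bar> \<le> K * \<bar>a - b\<bar>" and L: "\<And>a b. \<bar>G a - G b\<bar> \<le> L * \<bar>a - b\<bar>"
    and K0: "0 \<le> K" and L0: "0 \<le> L" and r: "r \<in> {R1..R2}"
  shows "(u1 r - u2 r)\<^sup>2 + (q1 r - q2 r)\<^sup>2 \<le> (u1 R1 - u2 R1)\<^sup>2 * exp ((K + L) * (r - R1))"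
proof -
  let ?E = "\<lambda>r. (u1 r - u2 r)\<^sup>2 + (q1 r - q2 r)\<^sup>2"
  let ?E' = "\<lambda>r. 2 * (u1 r - u2 r) * (\<Phi> (q1 r) - \<Phi> (q2 r)) +
     2 * (q1 r - q2 r) * ((- G (u1 r) - n / r * q1 r) - (- G (u2 r) - n / r * q2 r))"
  have cont: "continuous_on {R1..r} u1" "continuous_on {R1..r} u2" "continuous_on {R1..r} q1" "continuous_on {R1..r} q2"
    using fl1 fl2 radial_flow_u_cont[OF fl1] radial_flow_u_cont[OF fl2] r
    by (auto simp: radial_flow_def elim!: continuous_on_subset)
  have "?E r \<le> ?E R1 * exp ((K + L) * (r - R1))"
  proof (rule gronwall_forward[where E' = ?E'])
    show "continuous_on {R1..r} ?E" by (intro continuous_intros cont)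
  next
    fix s assume s: "R1 < s" "s < r"
    then have s': "s \<in> {R1<..<R2}" using r by auto
    show "(?E has_real_derivative ?E' s) (at s)"
      by (auto intro!: derivative_eq_intros radial_flow_u_deriv[OF fl1 s'] radial_flow_u_deriv[OF fl2 s']
          radial_flow_q_deriv[OF fl1 R1 s'] radial_flow_q_deriv[OF fl2 R1 s'] simp: algebra_simps add_divide_distrib diff_divide_distrib)
    have 1: "2 * (u1 s - u2 s) * (\<Phi> (q1 s) - \<Phi> (q2 s)) \<le> K * ?E s"
      using two_mult_lipschitz_bound[OF K K0] by (meson abs_le_D1)
    have 2: "2 * (q1 s - q2 s) * (G (u2 s) - G (u1 s)) \<le> L * ?E s"
      using two_mult_lipschitz_bound[OF L L0, of "q1 s - q2 s" "u2 s" "u1 s"]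
      by (simp add: power2_commute[of "u2 s"] add.commute abs_le_iff)
    have 3: "0 \<le> n / s * (q1 s - q2 s)\<^sup>2" using s R1 by simp
    have "?E' s = 2 * (u1 s - u2 s) * (\<Phi> (q1 s) - \<Phi> (q2 s)) +
        2 * (q1 s - q2 s) * (G (u2 s) - G (u1 s)) - 2 * (n / s * (q1 s - q2 s)\<^sup>2)"
      by (simp add: algebra_simps power2_eq_square)
    then show "?E' s \<le> (K + L) * ?E s"
      using 1 2 3 by (simp only: distrib_right)
  qed (use r in auto)
  then show ?thesis using fl1 fl2 by (simp add: radial_flow_def)
qed

text \<open>Backwards in r the friction term has the wrong sign, but on [s,r] with s > R1 it is bounded by
2n/s times the energy, so the energy vanishes on each such interval. Continuity of u then
carries the value e down to R1, which may be 0.\<close>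

lemma radial_flow_avoids_equilibrium:
  assumes fl: "radial_flow n R1 R2 \<Phi> G u q" and R1: "0 \<le> R1"
    and K: "\<And>a. \<bar>\<Phi> a\<bar> \<le> K * \<bar>a\<bar>" and L: "\<And>a. \<bar>G a\<bar> \<le> L * \<bar>a - e\<bar>"
    and K0: "0 \<le> K" and L0: "0 \<le> L" and r: "r \<in> {R1..R2}"
    and eq: "u r = e" "q r = 0"
  shows "u R1 = e"
proof (cases "r = R1")
  case False
  then have rR: "R1 < r" using r by auto
  let ?E = "\<lambda>r. (u r - e)\<^sup>2 + (q r)\<^sup>2"
  let ?E' = "\<lambda>r. 2 * (u r - e) * \<Phi> (q r) + 2 * q r * (- G (u r) - n / r * q r)"
  have ue: "u s = e" if s: "s \<in> {R1<..r}" for s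
  proof -
    let ?C = "K + L + 2 * n / s"
    have s0: "0 < s" using s R1 by auto
    have "?E s \<le> ?E r * exp (?C * (r - s))"
    proof (rule gronwall_backward[where E' = ?E'])
      have "continuous_on {s..r} u" "continuous_on {s..r} q"
        using fl radial_flow_u_cont[OF fl] r s
        by (auto simp: radial_flow_def elim!: continuous_on_subset)
      then show "continuous_on {s..r} ?E" by (intro continuous_intros)
    next
      fix t assume t: "s < t" "t < r"
      then have t': "t \<in> {R1<..<R2}" using r s by auto
      show "(?E has_real_derivative ?E' t) (at t)"
        by (auto intro!: derivative_eq_intros radial_flow_u_deriv[OF fl t'] radial_flow_q_deriv[OF fl R1 t']
            simp: algebra_simps)
      have 1: "- (2 * (u t - e) * \<Phi> (q t)) \<le> K * ?E t"
        using two_mult_lipschitz_bound[OF K K0, of "u t - e" "q t"] by linarith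
      have 2: "2 * q t * G (u t) \<le> L * ?E t"
        using two_mult_lipschitz_bound[OF L L0, of "q t" "u t"] by (simp add: add.commute)
      have "n / t * (q t)\<^sup>2 \<le> n / s * (q t)\<^sup>2"
        using s0 t by (intro mult_right_mono divide_left_mono) auto
      also have "\<dots> \<le> n / s * ?E t" using s0 by (intro mult_left_mono) auto
      finally have 3: "2 * n / t * (q t)\<^sup>2 \<le> 2 * n / s * ?E t" by simp
      have "- ?E' t = - (2 * (u t - e) * \<Phi> (q t)) + 2 * q t * G (u t) + 2 * n / t * (q t)\<^sup>2"
        by (simp add: algebra_simps power2_eq_square)
      also have "\<dots> \<le> ?C * ?E t"
        using 1 2 3 by (simp only: distrib_right)
      finally show "- (?C * ?E t) \<le> ?E' t" by linarith
    qed (use s in auto)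
    then have "?E s \<le> 0" using eq by simp
    then have "(u s - e)\<^sup>2 \<le> 0" using zero_le_power2[of "q s"] by linarith
    then show ?thesis by simp
  qed
  have "closure {R1<..r} \<subseteq> {R1..R2}" "R1 \<in> closure {R1<..r}" using rR r by auto
  then show ?thesis
    using continuous_constant_on_closure[of "{R1<..r}" u e R1] ue
      continuous_on_subset[OF radial_flow_u_cont[OF fl], of "closure {R1<..r}"] by blast
qed (use eq in simp)

text \<open>Integrating the second equation gives q = - radial_mean of G \<circ> u, where the weight
t^n/s^n lies between 0 and 1. For s = R1 = 0 and n > 0 the division by zero yields the limit value 0.\<close>

definition radial_mean :: "nat \<Rightarrow> real \<Rightarrow> (real \<Rightarrow> real) \<Rightarrow> real \<Rightarrow> real" where
  "radial_mean n R1 g s = integral {R1..s} (\<lambda>t. t ^ n * g t) / s ^ n"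

lemma radial_mean_diff_le:
  assumes R1: "0 \<le> R1" and g: "continuous_on {R1..s} g" and h: "continuous_on {R1..s} h"
    and b: "continuous_on {R1..s} b" and "R1 \<le> s"
    and le: "\<And>t. t \<in> {R1..s} \<Longrightarrow> \<bar>g t - h t\<bar> \<le> b t"
  shows "\<bar>radial_mean n R1 g s - radial_mean n R1 h s\<bar> \<le> integral {R1..s} b"
proof (cases "s = 0")
  case True
  then have "s = R1" using R1 \<open>R1 \<le> s\<close> by simp
  then show ?thesis by (simp add: radial_mean_def)
next
  case False
  then have s: "0 < s" using R1 \<open>R1 \<le> s\<close> by simp
  have ig: "(\<lambda>t. t ^ n * g t) integrable_on {R1..s}" "(\<lambda>t. t ^ n * h t) integrable_on {R1..s}"
    by (auto intro!: integrable_continuous_real continuous_intros g h)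
  have "radial_mean n R1 g s - radial_mean n R1 h s = integral {R1..s} (\<lambda>t. t ^ n * g t - t ^ n * h t) / s ^ n"
    by (simp add: radial_mean_def integral_diff[OF ig] diff_divide_distrib)
  moreover have "norm (integral {R1..s} (\<lambda>t. t ^ n * g t - t ^ n * h t)) \<le> integral {R1..s} (\<lambda>t. s ^ n * b t)"
  proof (rule integral_norm_bound_integral)
    fix t assume t: "t \<in> {R1..s}"
    have "norm (t ^ n * g t - t ^ n * h t) = t ^ n * \<bar>g t - h t\<bar>"
      using t R1 by (simp add: right_diff_distrib[symmetric] abs_mult)
    also have "\<dots> \<le> s ^ n * b t"
      using t R1 le[OF t] by (intro mult_mono power_mono) auto
    finally show "norm (t ^ n * g t - t ^ n * h t) \<le> s ^ n * b t" .
  qed (auto intro!: integrable_continuous_real continuous_intros g h b)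
  ultimately show ?thesis
    using s by (simp add: abs_divide divide_le_eq mult.commute)
qed

lemma radial_mean_cont:
  assumes R1: "0 \<le> R1" and g: "continuous_on {R1..R2} g"
  shows "continuous_on {R1..R2} (radial_mean n R1 g)"
proof (cases "R1 = 0")
  case False
  then show ?thesis unfolding radial_mean_def
    using R1 by (intro continuous_intros indefinite_integral_continuous_1 integrable_continuous_real g) auto
next
  case True
  show ?thesis
  proof (cases "0 < R2")
    case R2: True
    obtain B where B: "\<And>t. t \<in> {R1..R2} \<Longrightarrow> \<bar>g t\<bar> \<le> B"
      using compact_imp_bounded[OF compact_continuous_image[OF g compact_Icc]]
      unfolding bounded_iff by fastforce
    have bd: "\<bar>radial_mean n R1 g s\<bar> \<le> B * s" if s: "s \<in> {R1..R2}" for s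
    proof -
      have "\<bar>radial_mean n R1 g s - radial_mean n R1 (\<lambda>_. 0) s\<bar> \<le> integral {R1..s} (\<lambda>_. B)"
        using s B by (intro radial_mean_diff_le R1 continuous_on_subset[OF g]) auto
      then show ?thesis using s True by (simp add: radial_mean_def mult.commute)
    qed
    have z: "radial_mean n R1 g 0 = 0" by (simp add: radial_mean_def True)
    have "continuous (at s within {R1..R2}) (radial_mean n R1 g)" if s: "s \<in> {R1..R2}" for s
    proof (cases "s = 0")
      case True
      have "((\<lambda>s. radial_mean n R1 g s) \<longlongrightarrow> 0) (at 0 within {R1..R2})"
      proof (rule Lim_null_comparison)
        show "\<forall>\<^sub>F x in at 0 within {R1..R2}. norm (radial_mean n R1 g x) \<le> B * x"
          using bd by (auto simp: eventually_at_filter)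
        show "((*) B \<longlongrightarrow> 0) (at 0 within {R1..R2})"
          by (rule tendsto_eq_intros refl | simp)+
      qed
      then show ?thesis by (simp add: continuous_within True z)
    next
      case False
      have "continuous_on {R1..R2} (\<lambda>s. integral {R1..s} (\<lambda>t. t ^ n * g t))"
        by (intro indefinite_integral_continuous_1 integrable_continuous_real continuous_intros g)
      then have "continuous (at s within {R1..R2}) (\<lambda>s. integral {R1..s} (\<lambda>t. t ^ n * g t))"
        using s by (simp add: continuous_on_eq_continuous_within)
      then show ?thesis unfolding radial_mean_def
        by (intro continuous_intros) (use False in auto)
    qed
    then show ?thesis by (simp add: continuous_on_eq_continuous_within)
  next
    case False
    then have "{R1..R2} \<subseteq> {0}" using True by auto
    then show ?thesis by (rule continuous_on_subset[rotated]) auto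
  qed
qed

lemma lipschitz_imp_continuous:
  fixes F :: "real \<Rightarrow> real"
  assumes "\<And>a b. \<bar>F a - F b\<bar> \<le> K * \<bar>a - b\<bar>" and "0 \<le> K"
  shows "continuous_on S F"
  by (rule continuous_on_subset[OF lipschitz_on_continuous_on[of K UNIV]])
     (use assms in \<open>auto simp: lipschitz_on_def dist_real_def\<close>)

text \<open>The system is the fixed point equation u(r) = d + \<integral>{R1..r} \<Phi>(q), where q is minus the radial
mean of G \<circ> u. Each of the two integrations gains a factor 1/\<kappa> in the norm
sup over r of |e^(-\<kappa> r) u(r)|, so for large \<kappa> the map is a contraction on the whole interval at
once. The fixed point is sought for v(r) = e^(-\<kappa> r) u(r), extended by constants outside
[R1,R2] to be an element of the space of bounded continuous functions.\<close>

lemma radial_flow_exists: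
  assumes R1: "0 \<le> R1" and R: "R1 \<le> R2"
    and K: "\<And>a b. \<bar>\<Phi> a - \<Phi> b\<bar> \<le> K * \<bar>a - b\<bar>" and L: "\<And>a b. \<bar>G a - G b\<bar> \<le> L * \<bar>a - b\<bar>"
    and K0: "0 \<le> K" and L0: "0 \<le> L"
  obtains u q where "radial_flow n R1 R2 \<Phi> G u q" "u R1 = d"
proof -
  define \<kappa> where "\<kappa> = 2 * K * L + 1"
  have KL0: "0 \<le> K * L" using K0 L0 by simp
  have \<kappa>: "1 \<le> \<kappa>" using KL0 by (simp add: \<kappa>_def mult.assoc)
  \<comment> \<open>The Lipschitz constant of the map is at most K L / \<kappa>^2.\<close>
  have contr: "K * L / \<kappa>\<^sup>2 \<le> 1/2"
  proof -
    have "2 * (K * L) \<le> \<kappa>" by (simp add: \<kappa>_def)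
    also have "\<kappa> \<le> \<kappa>\<^sup>2" using \<kappa> by (simp add: power2_eq_square)
    finally show ?thesis using \<kappa> by (simp add: field_simps)
  qed
  define c where "c r = max R1 (min R2 r)" for r :: real
  have c_in: "c r \<in> {R1..R2}" for r using R by (auto simp: c_def)
  have c_id: "c r = r" if "r \<in> {R1..R2}" for r using that by (auto simp: c_def)
  have c_cont: "continuous_on UNIV c" unfolding c_def by (intro continuous_intros)
  define g where "g v t = G (exp (\<kappa> * t) * apply_bcontfun v t)" for v :: "real \<Rightarrow>\<^sub>C real" and t
  define Q where "Q v s = - radial_mean n R1 (g v) s" for v :: "real \<Rightarrow>\<^sub>C real" and s
  define J where "J v r = d + integral {R1..r} (\<lambda>s. \<Phi> (Q v s))" for v :: "real \<Rightarrow>\<^sub>C real" and r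
  define T where "T v = Bcontfun (\<lambda>r. exp (- \<kappa> * c r) * J v (c r))" for v :: "real \<Rightarrow>\<^sub>C real"
  have \<Phi>c: "continuous_on S \<Phi>" and Gc: "continuous_on S G" for S
    by (rule lipschitz_imp_continuous[OF K K0] lipschitz_imp_continuous[OF L L0])+
  have gc: "continuous_on S (g v)" for v S
    unfolding g_def
    by (intro continuous_on_compose2[OF Gc[of UNIV]] continuous_intros) auto
  have Qc: "continuous_on {R1..R2} (Q v)" for v
    unfolding Q_def by (intro continuous_intros radial_mean_cont R1 gc)
  have \<Phi>Qc: "continuous_on {R1..R2} (\<lambda>s. \<Phi> (Q v s))" for v
    by (intro continuous_on_compose2[OF \<Phi>c[of UNIV] Qc]) auto
  have Jc: "continuous_on {R1..R2} (J v)" for v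
    unfolding J_def by (intro continuous_intros indefinite_integral_continuous_1 integrable_continuous_real \<Phi>Qc)
  have Tb: "(\<lambda>r. exp (- \<kappa> * c r) * J v (c r)) \<in> bcontfun" for v
  proof -
    have w: "continuous_on {R1..R2} (\<lambda>r. exp (- \<kappa> * r) * J v r)" by (intro continuous_intros Jc)
    have "range (\<lambda>r. exp (- \<kappa> * c r) * J v (c r)) \<subseteq> (\<lambda>r. exp (- \<kappa> * r) * J v r) ` {R1..R2}"
      using c_in by auto
    then have "bounded (range (\<lambda>r. exp (- \<kappa> * c r) * J v (c r)))"
      using compact_imp_bounded[OF compact_continuous_image[OF w compact_Icc]] bounded_subset by blast
    moreover have "continuous_on UNIV (\<lambda>r. exp (- \<kappa> * c r) * J v (c r))"
      by (rule continuous_on_compose2[OF w c_cont]) (use c_in in auto)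
    ultimately show ?thesis by (simp add: bcontfun_def)
  qed
  have T_apply: "apply_bcontfun (T v) r = exp (- \<kappa> * c r) * J v (c r)" for v r
    by (simp only: T_def Bcontfun_inverse[OF Tb])
  have exp_int: "integral {R1..s} (\<lambda>t. exp (\<kappa> * t)) \<le> exp (\<kappa> * s) / \<kappa>" if "R1 \<le> s" for s
  proof -
    have "((\<lambda>t. exp (\<kappa> * t)) has_integral (exp (\<kappa> * s) / \<kappa> - exp (\<kappa> * R1) / \<kappa>)) {R1..s}"
      by (rule fundamental_theorem_of_calculus[OF that])
         (use \<kappa> in \<open>auto intro!: derivative_eq_intros simp: has_real_derivative_iff_has_vector_derivative[symmetric]\<close>)
    then have "integral {R1..s} (\<lambda>t. exp (\<kappa> * t)) = exp (\<kappa> * s) / \<kappa> - exp (\<kappa> * R1) / \<kappa>"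
      by (rule integral_unique)
    then show ?thesis using \<kappa> by simp
  qed
  have "\<exists>!v. T v = v"
  proof (rule banach_fix_type[of "1/2"]; (intro allI)?)
    fix v w :: "real \<Rightarrow>\<^sub>C real"
    let ?D = "dist v w"
    have Qd: "\<bar>Q v s - Q w s\<bar> \<le> L * ?D / \<kappa> * exp (\<kappa> * s)" if s: "s \<in> {R1..R2}" for s
    proof -
      have "\<bar>Q v s - Q w s\<bar> \<le> integral {R1..s} (\<lambda>t. L * ?D * exp (\<kappa> * t))"
        unfolding Q_def minus_diff_minus abs_minus_cancel
      proof (rule radial_mean_diff_le[OF R1])
        fix t
        have "\<bar>g v t - g w t\<bar> \<le> L * \<bar>exp (\<kappa> * t) * apply_bcontfun v t - exp (\<kappa> * t) * apply_bcontfun w t\<bar>"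
          unfolding g_def by (rule L)
        also have "\<dots> = L * exp (\<kappa> * t) * dist (apply_bcontfun v t) (apply_bcontfun w t)"
          by (simp add: dist_real_def right_diff_distrib[symmetric] abs_mult)
        also have "\<dots> \<le> L * exp (\<kappa> * t) * ?D"
          using L0 by (intro mult_left_mono dist_bounded) auto
        finally show "\<bar>g v t - g w t\<bar> \<le> L * ?D * exp (\<kappa> * t)" by (simp add: mult_ac)
      qed (use s in \<open>auto intro!: gc continuous_intros\<close>)
      also have "\<dots> = L * ?D * integral {R1..s} (\<lambda>t. exp (\<kappa> * t))" by simp
      also have "\<dots> \<le> L * ?D * (exp (\<kappa> * s) / \<kappa>)"
        using s L0 by (intro mult_left_mono exp_int) auto
      finally show ?thesis by simp
    qed
    have Jd: "\<bar>J v r - J w r\<bar> \<le> exp (\<kappa> * r) * (1/2 * ?D)" if r: "r \<in> {R1..R2}" for r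
    proof -
      have sub: "continuous_on {R1..r} (\<lambda>s. \<Phi> (Q v s))" for v :: "real \<Rightarrow>\<^sub>C real"
        by (rule continuous_on_subset[OF \<Phi>Qc]) (use r in auto)
      have "J v r - J w r = integral {R1..r} (\<lambda>s. \<Phi> (Q v s) - \<Phi> (Q w s))"
        unfolding J_def by (subst integral_diff) (auto intro!: integrable_continuous_real sub)
      also have "norm \<dots> \<le> integral {R1..r} (\<lambda>s. K * L * ?D / \<kappa> * exp (\<kappa> * s))"
      proof (rule integral_norm_bound_integral)
        fix s assume s: "s \<in> {R1..r}"
        have "\<bar>\<Phi> (Q v s) - \<Phi> (Q w s)\<bar> \<le> K * \<bar>Q v s - Q w s\<bar>" by (rule K)
        also have "\<dots> \<le> K * (L * ?D / \<kappa> * exp (\<kappa> * s))"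
          using s r K0 by (intro mult_left_mono Qd) auto
        finally show "norm (\<Phi> (Q v s) - \<Phi> (Q w s)) \<le> K * L * ?D / \<kappa> * exp (\<kappa> * s)" by simp
      qed (use \<kappa> in \<open>auto intro!: integrable_continuous_real continuous_intros sub\<close>)
      also have "\<dots> = K * L * ?D / \<kappa> * integral {R1..r} (\<lambda>s. exp (\<kappa> * s))" by (rule integral_mult_right)
      also have "\<dots> \<le> K * L * ?D / \<kappa> * (exp (\<kappa> * r) / \<kappa>)"
        using r \<kappa> KL0 by (intro mult_left_mono exp_int) auto
      also have "\<dots> = K * L / \<kappa>\<^sup>2 * (?D * exp (\<kappa> * r))" by (simp add: power2_eq_square)
      also have "\<dots> \<le> 1/2 * (?D * exp (\<kappa> * r))"
        by (intro mult_right_mono contr) auto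
      finally show ?thesis by (simp add: mult_ac)
    qed
    show "dist (T v) (T w) \<le> 1/2 * ?D"
    proof (rule dist_bound)
      fix r
      have "dist (apply_bcontfun (T v) r) (apply_bcontfun (T w) r) = exp (- \<kappa> * c r) * \<bar>J v (c r) - J w (c r)\<bar>"
        by (simp add: T_apply dist_real_def right_diff_distrib[symmetric] abs_mult)
      also have "\<dots> \<le> exp (- \<kappa> * c r) * (exp (\<kappa> * c r) * (1/2 * ?D))"
        by (intro mult_left_mono Jd c_in) auto
      also have "\<dots> = 1/2 * ?D" by (simp add: mult.assoc[symmetric] exp_add[symmetric])
      finally show "dist (apply_bcontfun (T v) r) (apply_bcontfun (T w) r) \<le> 1/2 * ?D" .
    qed
  qed auto
  then obtain v where v: "T v = v" by blast
  have uJ: "exp (\<kappa> * r) * apply_bcontfun v r = J v r" if "r \<in> {R1..R2}" for r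
    using T_apply[of v r] that by (simp add: v c_id mult.assoc[symmetric] exp_add[symmetric])
  have "radial_flow n R1 R2 \<Phi> G (J v) (Q v)"
    unfolding radial_flow_def
  proof (intro conjI ballI)
    fix r assume r: "r \<in> {R1..R2}"
    show "(J v has_real_derivative \<Phi> (Q v r)) (at r within {R1..R2})"
      unfolding J_def using integral_has_real_derivative[OF \<Phi>Qc r]
      by (auto intro!: derivative_eq_intros)
  next
    fix r assume r: "r \<in> {R1<..<R2}"
    have "((\<lambda>s. integral {R1..s} (\<lambda>t. t ^ n * g v t)) has_real_derivative r ^ n * g v r) (at r within {R1..R2})"
      by (rule integral_has_real_derivative) (use r in \<open>auto intro!: continuous_intros gc\<close>)
    moreover have "at r within {R1..R2} = at r"
      using r by (auto intro!: at_within_interior)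
    ultimately have "((\<lambda>s. - integral {R1..s} (\<lambda>t. t ^ n * g v t)) has_real_derivative - (r ^ n * g v r)) (at r)"
      by (auto intro!: derivative_eq_intros)
    moreover have "g v r = G (J v r)" using uJ r by (simp add: g_def)
    ultimately show "((\<lambda>s. s ^ n * Q v s) has_real_derivative - (r ^ n * G (J v r))) (at r)"
      using r R1 by (auto intro: has_field_derivative_transform_within_open[of _ _ _ "{0<..}"]
           simp: Q_def radial_mean_def)
  next
    show "Q v R1 = 0" by (simp add: Q_def radial_mean_def)
  qed (rule Qc)
  moreover have "J v R1 = d" by (simp add: J_def)
  ultimately show ?thesis by (rule that)
qed

section \<open>Angles of planar curves and their comparison\<close>

text \<open>Curves are considered in the phase plane of displacement x and flux y = r^n q. Unlike
u and q these satisfy equations without a singular friction term, and both derivatives are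
continuous up to the end points, even for R1 = 0.\<close>

definition planar_curve ::
  "real \<Rightarrow> real \<Rightarrow> (real \<Rightarrow> real) \<Rightarrow> (real \<Rightarrow> real) \<Rightarrow> (real \<Rightarrow> real) \<Rightarrow> (real \<Rightarrow> real) \<Rightarrow> bool" where
  "planar_curve a b x y x' y' \<longleftrightarrow>
     a < b \<and> continuous_on {a..b} x \<and> continuous_on {a..b} y \<and>
     continuous_on {a..b} x' \<and> continuous_on {a..b} y' \<and>
     (\<forall>r\<in>{a<..<b}. (x has_real_derivative x' r) (at r) \<and> (y has_real_derivative y' r) (at r)) \<and>
     (\<forall>r\<in>{a..b}. 0 < (x r)\<^sup>2 + (y r)\<^sup>2) \<and> y a = 0"

text \<open>This is the clockwise angular velocity of (x,y). Clockwise is the positive sense because, for solutions of the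
radial system with u > 0, x' has the sign of y and y' the sign of -x.\<close>

definition rotation_rate ::
  "(real \<Rightarrow> real) \<Rightarrow> (real \<Rightarrow> real) \<Rightarrow> (real \<Rightarrow> real) \<Rightarrow> (real \<Rightarrow> real) \<Rightarrow> real \<Rightarrow> real" where
  "rotation_rate x y x' y' t = (y t * x' t - x t * y' t) / ((x t)\<^sup>2 + (y t)\<^sup>2)"

definition rotation_angle ::
  "real \<Rightarrow> (real \<Rightarrow> real) \<Rightarrow> (real \<Rightarrow> real) \<Rightarrow> (real \<Rightarrow> real) \<Rightarrow> (real \<Rightarrow> real) \<Rightarrow> real \<Rightarrow> real" where
  "rotation_angle a x y x' y' r = integral {a..r} (rotation_rate x y x' y')"

lemma rotation_rate_cont:
  assumes "planar_curve a b x y x' y'"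
  shows "continuous_on {a..b} (rotation_rate x y x' y')"
  unfolding rotation_rate_def using assms
  by (intro continuous_intros) (force simp: planar_curve_def)+

lemma rotation_angle_cont:
  assumes "planar_curve a b x y x' y'"
  shows "continuous_on {a..b} (rotation_angle a x y x' y')"
  unfolding rotation_angle_def
  by (intro indefinite_integral_continuous_1 integrable_continuous_real rotation_rate_cont[OF assms])

lemma rotation_angle_deriv:
  assumes "planar_curve a b x y x' y'" "r \<in> {a<..<b}"
  shows "(rotation_angle a x y x' y' has_real_derivative rotation_rate x y x' y' r) (at r)"
proof -
  have "(rotation_angle a x y x' y' has_real_derivative rotation_rate x y x' y' r) (at r within {a..b})"
    unfolding rotation_angle_def
    by (rule integral_has_real_derivative[OF rotation_rate_cont[OF assms(1)]]) (use assms in auto)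
  moreover have "at r within {a..b} = at r"
    using assms by (auto intro!: at_within_interior)
  ultimately show ?thesis by simp
qed

lemma rotation_angle_start [simp]: "rotation_angle a x y x' y' a = 0"
  by (simp add: rotation_angle_def)

lemma rotation_derivative_identity:
  fixes x y x' y' C S :: real
  assumes "0 < x\<^sup>2 + y\<^sup>2"
  shows "(y * x' - x * y') / (x\<^sup>2 + y\<^sup>2) * (x * C - y * S) + x' * S + y' * C
       = (x * x' + y * y') / (x\<^sup>2 + y\<^sup>2) * (x * S + y * C)"
proof -
  define R where "R = x\<^sup>2 + y\<^sup>2"
  have R: "R \<noteq> 0" using assms unfolding R_def by linarith
  have "(y * x' - x * y') * (x * C - y * S) + (x' * S + y' * C) * R
      = (x * x' + y * y') * (x * S + y * C)"
    unfolding R_def by (simp add: algebra_simps power2_eq_square)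
  then show ?thesis unfolding R_def[symmetric] using R by (simp add: field_simps)
qed

lemma planar_curve_start: "planar_curve a b x y x' y' \<Longrightarrow> x a \<noteq> 0"
  by (force simp: planar_curve_def)

text \<open>Rotating (x,y) back by the angle \<theta> gives coordinates (c,s). By the choice of \<theta>' the
second one satisfies the homogeneous linear equation s' = \<kappa> s, hence vanishes identically, and then
the first one has no zero and keeps the sign of x(a).\<close>

lemma planar_curve_polar:
  assumes pc: "planar_curve a b x y x' y'" and r: "r \<in> {a..b}"
  obtains m where "0 < m"
    "x r = x a * m * cos (rotation_angle a x y x' y' r)"
    "y r = - (x a * m * sin (rotation_angle a x y x' y' r))"
proof -
  let ?\<theta> = "rotation_angle a x y x' y'"
  define s where "s t = x t * sin (?\<theta> t) + y t * cos (?\<theta> t)" for t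
  define c where "c t = x t * cos (?\<theta> t) - y t * sin (?\<theta> t)" for t
  define \<kappa> where "\<kappa> t = (x t * x' t + y t * y' t) / ((x t)\<^sup>2 + (y t)\<^sup>2)" for t
  note cont = rotation_angle_cont[OF pc]
  have conts: "continuous_on {a..b} x" "continuous_on {a..b} y" "continuous_on {a..b} x'" "continuous_on {a..b} y'"
    and pos: "\<And>t. t \<in> {a..b} \<Longrightarrow> 0 < (x t)\<^sup>2 + (y t)\<^sup>2" and ya: "y a = 0" and ab: "a < b"
    using pc by (auto simp: planar_curve_def)
  have "continuous_on {a..b} \<kappa>"
    unfolding \<kappa>_def using pos by (intro continuous_intros conts) force
  from compact_imp_bounded[OF compact_continuous_image[OF this compact_Icc]]
  obtain C where C: "\<And>t. t \<in> {a..b} \<Longrightarrow> \<bar>\<kappa> t\<bar> \<le> C"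
    unfolding bounded_iff by fastforce
  have s0: "s t = 0" if t: "t \<in> {a..b}" for t
  proof -
    have "(s t)\<^sup>2 \<le> (s a)\<^sup>2 * exp (2 * C * (t - a))"
    proof (rule gronwall_forward[where E' = "\<lambda>t. 2 * s t * (\<kappa> t * s t)"])
      show "continuous_on {a..t} (\<lambda>t. (s t)\<^sup>2)"
        unfolding s_def using t
        by (intro continuous_intros continuous_on_subset[OF conts(1)] continuous_on_subset[OF conts(2)]
             continuous_on_subset[OF cont]) auto
    next
      fix r assume "a < r" "r < t"
      then have r: "r \<in> {a<..<b}" using t by auto
      have d: "(x has_real_derivative x' r) (at r)" "(y has_real_derivative y' r) (at r)"
        using pc r by (auto simp: planar_curve_def)
      have "(s has_real_derivative
          rotation_rate x y x' y' r * c r + x' r * sin (?\<theta> r) + y' r * cos (?\<theta> r)) (at r)"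
        unfolding s_def c_def
        by (auto intro!: derivative_eq_intros d rotation_angle_deriv[OF pc r] simp: algebra_simps)
      also have "rotation_rate x y x' y' r * c r + x' r * sin (?\<theta> r) + y' r * cos (?\<theta> r) = \<kappa> r * s r"
        unfolding rotation_rate_def c_def \<kappa>_def s_def
        by (rule rotation_derivative_identity) (use pos r in auto)
      finally show "((\<lambda>t. (s t)\<^sup>2) has_real_derivative 2 * s r * (\<kappa> r * s r)) (at r)"
        by (auto intro!: derivative_eq_intros)
      have "2 * \<kappa> r * (s r)\<^sup>2 \<le> 2 * C * (s r)\<^sup>2"
        using C[of r] r by (intro mult_right_mono) auto
      then show "2 * s r * (\<kappa> r * s r) \<le> 2 * C * (s r)\<^sup>2"
        by (simp add: power2_eq_square mult_ac)
    qed (use t in auto)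
    then show ?thesis using ya by (simp add: s_def)
  qed
  have c_ne: "c t \<noteq> 0" if t: "t \<in> {a..b}" for t
  proof
    assume "c t = 0"
    moreover have "(c t)\<^sup>2 + (s t)\<^sup>2 = ((x t)\<^sup>2 + (y t)\<^sup>2) * ((sin (?\<theta> t))\<^sup>2 + (cos (?\<theta> t))\<^sup>2)"
      unfolding c_def s_def by (simp only: power2_eq_square) algebra
    ultimately show False using s0[OF t] pos[OF t] by simp
  qed
  have ca: "c a = x a" by (simp add: c_def)
  have xa: "x a \<noteq> 0" using c_ne[of a] ab ca by simp
  have "0 < c r / x a"
  proof (rule ccontr)
    assume "\<not> 0 < c r / x a"
    moreover have "continuous_on {a..r} (\<lambda>t. c t / x a)"
      unfolding c_def using r xa
      by (intro continuous_intros continuous_on_subset[OF conts(1)] continuous_on_subset[OF conts(2)]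
             continuous_on_subset[OF cont]) auto
    ultimately obtain t where "a \<le> t" "t \<le> r" "c t / x a = 0"
      using IVT2'[of "\<lambda>t. c t / x a" r 0 a] r ca xa by auto
    then show False using c_ne[of t] r xa by auto
  qed
  moreover have "x r = c r * cos (?\<theta> r)"
  proof -
    have "c r * cos (?\<theta> r) + s r * sin (?\<theta> r) = x r * ((sin (?\<theta> r))\<^sup>2 + (cos (?\<theta> r))\<^sup>2)"
      unfolding c_def s_def by (simp only: power2_eq_square) algebra
    then show ?thesis using s0[OF r] by simp
  qed
  moreover have "y r = - (c r * sin (?\<theta> r))"
  proof -
    have "- (c r * sin (?\<theta> r)) + s r * cos (?\<theta> r) = y r * ((sin (?\<theta> r))\<^sup>2 + (cos (?\<theta> r))\<^sup>2)"
      unfolding c_def s_def by (simp only: power2_eq_square) algebra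
    then show ?thesis using s0[OF r] by simp
  qed
  ultimately show ?thesis using xa by (intro that[of "c r / x a"]) auto
qed

text \<open>An increasing \<theta> running from 0 to j\<pi> meets each of the j values (i+1/2)\<pi>, i<j, exactly
once.\<close>

lemma card_cos_zeros:
  fixes \<theta> :: "real \<Rightarrow> real"
  assumes ab: "a < b" and cont: "continuous_on {a..b} \<theta>"
    and mono: "\<And>s t. a \<le> s \<Longrightarrow> s < t \<Longrightarrow> t \<le> b \<Longrightarrow> \<theta> s < \<theta> t"
    and start: "\<theta> a = 0" and fin: "\<theta> b = real j * pi"
  shows "card {r\<in>{a<..<b}. cos (\<theta> r) = 0} = j"
proof -
  let ?h = "\<lambda>i. (real i + 1/2) * pi"
  have "bij_betw \<theta> {r\<in>{a<..<b}. cos (\<theta> r) = 0} (?h ` {..<j})"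
  proof (rule bij_betwI')
    fix s t assume "s \<in> {r\<in>{a<..<b}. cos (\<theta> r) = 0}" "t \<in> {r\<in>{a<..<b}. cos (\<theta> r) = 0}"
    then show "\<theta> s = \<theta> t \<longleftrightarrow> s = t"
      using mono[of s t] mono[of t s] by (cases s t rule: linorder_cases) auto
  next
    fix r assume r: "r \<in> {r\<in>{a<..<b}. cos (\<theta> r) = 0}"
    then obtain i where i: "\<theta> r = of_int i * pi + pi / 2"
      using cos_zero_iff_int2 by blast
    have "0 < \<theta> r" "\<theta> r < real j * pi" using mono[of a r] mono[of r b] r start fin by auto
    then have "0 < (of_int i + 1/2) * pi" "(of_int i + 1/2) * pi < real j * pi"
      by (auto simp: i algebra_simps)
    then have "0 < real_of_int i + 1/2" "real_of_int i + 1/2 < real j"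
      using pi_gt_zero by (auto simp: zero_less_mult_iff)
    then have "0 \<le> i" "i < int j" by linarith+
    then have "\<theta> r = ?h (nat i)" "nat i < j" by (auto simp: i algebra_simps)
    then show "\<theta> r \<in> ?h ` {..<j}" by blast
  next
    fix v assume "v \<in> ?h ` {..<j}"
    then obtain i where i: "i < j" "v = ?h i" by auto
    have v0: "0 < v" by (auto simp: i intro!: mult_pos_pos)
    have "real i + 1/2 < real j" using i by linarith
    then have v1: "v < real j * pi" unfolding i by (intro mult_strict_right_mono) auto
    obtain r where r: "a \<le> r" "r \<le> b" "\<theta> r = v"
      using IVT'[of \<theta> a v b] start fin v0 v1 ab cont by auto
    have "a \<noteq> r" "r \<noteq> b" using r v0 v1 start fin by auto
    moreover have "cos (\<theta> r) = 0"
      unfolding r(3) i(2) cos_zero_iff_int2 by (rule exI[of _ "int i"]) (simp add: algebra_simps)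
    ultimately show "\<exists>r\<in>{r\<in>{a<..<b}. cos (\<theta> r) = 0}. v = \<theta> r"
      using r by force
  qed
  then have "card {r\<in>{a<..<b}. cos (\<theta> r) = 0} = card (?h ` {..<j})"
    by (rule bij_betw_same_card)
  also have "\<dots> = j" by (subst card_image) (auto simp: inj_on_def)
  finally show ?thesis .
qed

lemma first_zero:
  fixes D :: "real \<Rightarrow> real"
  assumes ab: "a \<le> b" and cont: "continuous_on {a..b} D" and pos: "0 < D a" and nonpos: "D b \<le> 0"
  obtains t where "a < t" "t \<le> b" "D t = 0" "\<And>s. a \<le> s \<Longrightarrow> s < t \<Longrightarrow> 0 < D s"
proof -
  let ?Z = "{t \<in> {a..b}. D t = 0}"
  have "?Z \<noteq> {}" using IVT2'[of D b 0 a] nonpos pos ab cont by auto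
  moreover have "compact ?Z"
  proof -
    have "bounded ?Z" by (rule bounded_subset[of "{a..b}"]) auto
    then show ?thesis
      using continuous_closed_preimage_constant[OF cont, of 0] by (simp add: compact_eq_bounded_closed)
  qed
  ultimately have "\<exists>t\<in>?Z. \<forall>s\<in>?Z. t \<le> s" by (intro compact_attains_inf)
  then obtain t where t: "t \<in> ?Z" "\<And>s. s \<in> ?Z \<Longrightarrow> t \<le> s" by blast
  have "0 < D s" if st: "a \<le> s" "s < t" for s
  proof (rule ccontr)
    assume "\<not> 0 < D s"
    moreover have "continuous_on {a..s} D"
      using st t(1) by (intro continuous_on_subset[OF cont]) auto
    ultimately obtain v where "a \<le> v" "v \<le> s" "D v = 0"
      using IVT2'[of D s 0 a] pos st by auto
    then show False using t(2)[of v] st t(1) by auto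
  qed
  moreover have "a < t" using t(1) pos by (cases "a = t") auto
  ultimately show ?thesis using that t(1) by auto
qed

text \<open>Up to its first zero, D satisfies D' \<ge> -C D and hence stays above D(a) e^(-C(r-a)), so there is no
first zero.\<close>

lemma positive_of_deriv_ge_neg_abs:
  fixes D D' :: "real \<Rightarrow> real"
  assumes ab: "a \<le> b" and cont: "continuous_on {a..b} D"
    and der: "\<And>r. a < r \<Longrightarrow> r < b \<Longrightarrow> (D has_real_derivative D' r) (at r)"
    and ge: "\<And>r. a < r \<Longrightarrow> r < b \<Longrightarrow> - (C * \<bar>D r\<bar>) \<le> D' r"
    and pos: "0 < D a"
  shows "0 < D b"
proof (rule ccontr)
  assume "\<not> 0 < D b"
  then obtain t where t: "a < t" "t \<le> b" "D t = 0" and Dp: "\<And>s. a \<le> s \<Longrightarrow> s < t \<Longrightarrow> 0 < D s"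
    using first_zero[OF ab cont pos] by (metis not_less)
  have "D a \<le> D t * exp (C * (t - a))"
  proof (rule gronwall_backward[where E' = D'])
    show "continuous_on {a..t} D" using t by (auto intro: continuous_on_subset[OF cont])
    fix r assume "a < r" "r < t"
    then show "(D has_real_derivative D' r) (at r)" "- (C * D r) \<le> D' r"
      using der[of r] ge[of r] Dp[of r] t by auto
  qed (use t in auto)
  then show False using t pos by auto
qed

lemma abs_sin_sq_diff_le: "\<bar>(sin s)\<^sup>2 - (sin t)\<^sup>2\<bar> \<le> \<bar>s - t\<bar>" for s t :: real
proof -
  have "sin (s - t) * sin (s + t) = (sin s)\<^sup>2 * (cos t)\<^sup>2 - (cos s)\<^sup>2 * (sin t)\<^sup>2"
    by (simp add: sin_add sin_diff algebra_simps power2_eq_square)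
  then have "(sin s)\<^sup>2 - (sin t)\<^sup>2 = sin (s - t) * sin (s + t)"
    by (simp add: cos_squared_eq algebra_simps)
  then have "\<bar>(sin s)\<^sup>2 - (sin t)\<^sup>2\<bar> \<le> \<bar>sin (s - t)\<bar> * 1"
    by (simp only: abs_mult) (intro mult_left_mono, auto)
  also have "\<dots> \<le> \<bar>s - t\<bar>" using abs_sin_x_le_abs_x by simp
  finally show ?thesis .
qed

text \<open>Along the curves the two angles satisfy \<theta>' \<ge> F(r,\<theta>) and \<phi>' = F(r,\<phi>) with
F(r,\<theta>) = sin^2 \<theta>/\<rho> + \<mu>\<rho>cos^2 \<theta>, and F is Lipschitz in \<theta> uniformly on
[r0,b] for each r0 > a; so a strict inequality at r0 persists. At r = a the coefficient
1/\<rho> may blow up and this argument does not start. There the Wronskian x z - y w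
is used instead: it vanishes at a and has derivative at least (c-\<mu>)\<rho> x w > 0 as long as x and
w are positive, and its sign is that of sin(\<theta>-\<phi>).\<close>

lemma sturm_angle_comparison_pos:
  fixes x y x' y' w z w' z' \<rho> :: "real \<Rightarrow> real"
  assumes pc: "planar_curve a b x y x' y'" and pl: "planar_curve a b w z w' z'"
    and rho_pos: "\<And>r. a < r \<Longrightarrow> r \<le> b \<Longrightarrow> 0 < \<rho> r"
    and rho_mono: "\<And>s t. a \<le> s \<Longrightarrow> s \<le> t \<Longrightarrow> t \<le> b \<Longrightarrow> \<rho> s \<le> \<rho> t"
    and \<mu>: "0 \<le> \<mu>" "\<mu> < c"
    and w': "\<And>r. a < r \<Longrightarrow> r < b \<Longrightarrow> w' r = z r / \<rho> r"
    and z': "\<And>r. a < r \<Longrightarrow> r < b \<Longrightarrow> z' r = - (\<mu> * \<rho> r * w r)"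
    and x': "\<And>r. a < r \<Longrightarrow> r < b \<Longrightarrow> (y r)\<^sup>2 / \<rho> r \<le> y r * x' r"
    and y': "\<And>r. a < r \<Longrightarrow> r < b \<Longrightarrow> c * \<rho> r * (x r)\<^sup>2 \<le> - (x r * y' r)"
    and xa: "0 < x a" and wa: "0 < w a"
  shows "rotation_angle a w z w' z' b < rotation_angle a x y x' y' b"
proof -
  let ?\<theta> = "rotation_angle a x y x' y'" and ?\<phi> = "rotation_angle a w z w' z'"
  note \<theta>c = rotation_angle_cont[OF pc] and \<phi>c = rotation_angle_cont[OF pl]
  have ab: "a < b" using pc by (simp add: planar_curve_def)
  have "\<exists>d>0. \<forall>r\<in>{a..b}. dist r a < d \<longrightarrow> dist (f r) (f a) < pi/2"
    if "continuous_on {a..b} f" for f :: "real \<Rightarrow> real"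
  proof -
    have "a \<in> {a..b}" "0 < pi/2" using ab by auto
    with that show ?thesis unfolding continuous_on_iff by blast
  qed
  from this[OF \<theta>c] this[OF \<phi>c] obtain d1 d2 where d: "d1 > 0" "d2 > 0"
    "\<And>r. r \<in> {a..b} \<Longrightarrow> dist r a < d1 \<Longrightarrow> \<bar>?\<theta> r\<bar> < pi/2"
    "\<And>r. r \<in> {a..b} \<Longrightarrow> dist r a < d2 \<Longrightarrow> \<bar>?\<phi> r\<bar> < pi/2"
    by (auto simp: dist_real_def)
  define r0 where "r0 = min ((a + b) / 2) (a + min d1 d2 / 2)"
  have r0: "a < r0" "r0 < b" using ab d by (auto simp: r0_def min_def)
  have small: "\<bar>?\<theta> r\<bar> < pi/2" "\<bar>?\<phi> r\<bar> < pi/2" if "r \<in> {a..r0}" for r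
  proof -
    have "dist r a < d1" "dist r a < d2" using that d by (auto simp: dist_real_def r0_def min_def split: if_splits)
    then show "\<bar>?\<theta> r\<bar> < pi/2" "\<bar>?\<phi> r\<bar> < pi/2" using d(3,4)[of r] that r0 by auto
  qed
  have pos: "0 < x r \<and> 0 < w r" if r: "r \<in> {a..r0}" for r
  proof -
    have r': "r \<in> {a..b}" using r r0 by auto
    have "0 < cos (?\<theta> r)" "0 < cos (?\<phi> r)" using small[OF r] by (auto intro!: cos_gt_zero_pi)
    moreover obtain m where "0 < m" "x r = x a * m * cos (?\<theta> r)" by (rule planar_curve_polar[OF pc r'])
    moreover obtain k where "0 < k" "w r = w a * k * cos (?\<phi> r)" by (rule planar_curve_polar[OF pl r'])
    ultimately show ?thesis using xa wa by simp
  qed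
  have cont: "continuous_on {a..b} x" "continuous_on {a..b} y" "continuous_on {a..b} w" "continuous_on {a..b} z"
    using pc pl by (auto simp: planar_curve_def)
  note cont0 = cont[THEN continuous_on_subset]
  have der: "(x has_real_derivative x' r) (at r)" "(y has_real_derivative y' r) (at r)"
     "(w has_real_derivative w' r) (at r)" "(z has_real_derivative z' r) (at r)" if "r \<in> {a<..<b}" for r
    using pc pl that by (auto simp: planar_curve_def)
  have ya: "y a = 0" "z a = 0" using pc pl by (auto simp: planar_curve_def)
  have y'neg: "y' r < 0" if r: "a < r" "r < r0" for r
  proof -
    have "0 < c * \<rho> r * (x r)\<^sup>2" using pos[of r] rho_pos[of r] r r0 \<mu> by (intro mult_pos_pos) auto
    also have "\<dots> \<le> - (x r * y' r)" using y'[of r] r r0 by auto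
    finally show ?thesis using pos[of r] r by (simp add: mult_less_0_iff)
  qed
  have yneg: "y r < 0" if r: "a < r" "r < r0" for r
  proof -
    have "y r < y a"
    proof (rule DERIV_neg_imp_decreasing_open[OF r(1)])
      fix s assume s: "a < s" "s < r"
      then have "s \<in> {a<..<b}" "s < r0" using r r0 by auto
      then show "\<exists>v. (y has_real_derivative v) (at s) \<and> v < 0" using der(2) y'neg s by blast
    next
      show "continuous_on {a..r} y" using r r0 by (intro cont0) auto
    qed
    then show ?thesis using ya by simp
  qed
  have zneg: "z r \<le> 0" if r: "a < r" "r < r0" for r
  proof -
    have "z r \<le> z a"
    proof (rule DERIV_nonpos_imp_decreasing_open[of a r z])
      fix s assume s: "a < s" "s < r"
      have "z' s \<le> 0" using z'[of s] s r r0 \<mu> pos[of s] rho_pos[of s] by simp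
      then show "\<exists>y. (z has_real_derivative y) (at s) \<and> y \<le> 0" using der(4)[of s] s r r0 by auto
    qed (use r r0 in \<open>auto intro!: cont0\<close>)
    then show ?thesis using ya by simp
  qed
  let ?V = "\<lambda>r. x r * z r - y r * w r"
  have "?V a < ?V r0"
  proof (rule DERIV_pos_imp_increasing_open[OF r0(1)])
    fix r assume r: "a < r" "r < r0"
    then have r': "r \<in> {a<..<b}" "r < b" using r0 by auto
    have rp: "0 < \<rho> r" using rho_pos r r' by auto
    have p: "0 < x r" "0 < w r" using pos[of r] r by auto
    have 1: "y r / \<rho> r * z r \<le> x' r * z r"
    proof (rule mult_right_mono_neg)
      have "y r * (y r / \<rho> r) \<le> y r * x' r" using x'[of r] r r' by (simp add: power2_eq_square)
      then show "x' r \<le> y r / \<rho> r" using mult_le_cancel_left_neg[OF yneg[OF r]] by blast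
    qed (rule zneg[OF r])
    have 2: "c * \<rho> r * x r * w r \<le> - y' r * w r"
    proof (rule mult_right_mono)
      have "x r * (c * \<rho> r * x r) \<le> x r * (- y' r)" using y'[of r] r r' by (simp add: power2_eq_square mult_ac)
      then show "c * \<rho> r * x r \<le> - y' r" using p by (simp only: mult_le_cancel_left)
    qed (use p in auto)
    have 3: "0 < (c - \<mu>) * (\<rho> r * x r * w r)" using \<mu> rp p by (intro mult_pos_pos) auto
    have "(?V has_real_derivative x' r * z r + x r * z' r - (y' r * w r + y r * w' r)) (at r)"
      by (auto intro!: derivative_eq_intros der[OF r'(1)])
    moreover have "0 < x' r * z r + x r * z' r - (y' r * w r + y r * w' r)"
    proof -
      have "x r * z' r = - \<mu> * (\<rho> r * x r * w r)" "y r * w' r = y r / \<rho> r * z r"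
        using z'[of r] w'[of r] r r' by (auto simp: mult_ac)
      then show ?thesis using 1 2 3 by (simp add: algebra_simps)
    qed
    ultimately show "\<exists>y. (?V has_real_derivative y) (at r) \<and> 0 < y" by blast
  next
    show "continuous_on {a..r0} ?V" using r0 by (intro continuous_intros cont0) auto
  qed
  then have V: "0 < ?V r0" using ya by simp
  have r0': "r0 \<in> {a..b}" using r0 by auto
  have D0: "?\<phi> r0 < ?\<theta> r0"
  proof -
    obtain m where m: "0 < m" "x r0 = x a * m * cos (?\<theta> r0)" "y r0 = - (x a * m * sin (?\<theta> r0))"
      by (rule planar_curve_polar[OF pc r0'])
    obtain k where k: "0 < k" "w r0 = w a * k * cos (?\<phi> r0)" "z r0 = - (w a * k * sin (?\<phi> r0))"
      by (rule planar_curve_polar[OF pl r0'])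
    have "?V r0 = x a * m * w a * k * sin (?\<theta> r0 - ?\<phi> r0)"
      by (simp add: m k sin_diff algebra_simps)
    then have sp: "0 < sin (?\<theta> r0 - ?\<phi> r0)"
      using V m(1) k(1) xa wa by (metis mult_pos_pos zero_less_mult_pos)
    show ?thesis
    proof (rule ccontr)
      assume "\<not> ?thesis"
      then have "0 \<le> sin (?\<phi> r0 - ?\<theta> r0)"
        using small[of r0] r0 by (intro sin_ge_zero) auto
      then show False using sp sin_minus[of "?\<theta> r0 - ?\<phi> r0"] by simp
    qed
  qed
  \<comment> \<open>A Lipschitz constant on [r0, b] for the right-hand side of the angle equation.\<close>
  let ?C = "1 / \<rho> r0 + \<mu> * \<rho> b"
  have "0 < ?\<theta> b - ?\<phi> b"
  proof (rule positive_of_deriv_ge_neg_abs[where D = "\<lambda>r. ?\<theta> r - ?\<phi> r" and a = r0 and b = b and C = ?C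
        and D' = "\<lambda>r. rotation_rate x y x' y' r - rotation_rate w z w' z' r"])
    show "continuous_on {r0..b} (\<lambda>r. ?\<theta> r - ?\<phi> r)"
      using r0 by (intro continuous_intros continuous_on_subset[OF \<theta>c] continuous_on_subset[OF \<phi>c]) auto
  next
    fix r assume r: "r0 < r" "r < b"
    then have r': "r \<in> {a<..<b}" "r \<in> {a..b}" "a < r" using r0 by auto
    show "((\<lambda>r. ?\<theta> r - ?\<phi> r) has_real_derivative rotation_rate x y x' y' r - rotation_rate w z w' z' r) (at r)"
      by (intro derivative_intros rotation_angle_deriv[OF pc r'(1)] rotation_angle_deriv[OF pl r'(1)])
    obtain m where m: "0 < m" "x r = x a * m * cos (?\<theta> r)" "y r = - (x a * m * sin (?\<theta> r))"
      by (rule planar_curve_polar[OF pc r'(2)])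
    obtain k where k: "0 < k" "w r = w a * k * cos (?\<phi> r)" "z r = - (w a * k * sin (?\<phi> r))"
      by (rule planar_curve_polar[OF pl r'(2)])
    have rp: "0 < \<rho> r" "0 < \<rho> r0" "\<rho> r0 \<le> \<rho> r" "\<rho> r \<le> \<rho> b"
      using rho_pos[of r] rho_pos[of r0] rho_mono r r' r0 by auto
    define A where "A = x a * m"
    define B where "B = w a * k"
    have AB: "0 < A" "0 < B" using m(1) k(1) xa wa by (auto simp: A_def B_def)
    have N1: "(x r)\<^sup>2 + (y r)\<^sup>2 = A\<^sup>2" "(w r)\<^sup>2 + (z r)\<^sup>2 = B\<^sup>2"
      unfolding m k A_def[symmetric] B_def[symmetric]
      by (simp_all add: power_mult_distrib distrib_left[symmetric])
    have rate1: "rotation_rate x y x' y' r \<ge> (sin (?\<theta> r))\<^sup>2 / \<rho> r + \<mu> * \<rho> r * (cos (?\<theta> r))\<^sup>2"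
    proof -
      have "\<mu> * \<rho> r * (x r)\<^sup>2 \<le> c * \<rho> r * (x r)\<^sup>2" using \<mu> rp by (intro mult_right_mono) auto
      then have "(y r)\<^sup>2 / \<rho> r + \<mu> * \<rho> r * (x r)\<^sup>2 \<le> y r * x' r - x r * y' r"
        using x'[of r] y'[of r] r r' by auto
      moreover have "(y r)\<^sup>2 / \<rho> r + \<mu> * \<rho> r * (x r)\<^sup>2
          = ((sin (?\<theta> r))\<^sup>2 / \<rho> r + \<mu> * \<rho> r * (cos (?\<theta> r))\<^sup>2) * A\<^sup>2"
        unfolding m A_def[symmetric] by (simp add: power_mult_distrib algebra_simps)
      ultimately show ?thesis
        unfolding rotation_rate_def N1 using AB by (simp add: pos_le_divide_eq)
    qed
    have rate2: "rotation_rate w z w' z' r = (sin (?\<phi> r))\<^sup>2 / \<rho> r + \<mu> * \<rho> r * (cos (?\<phi> r))\<^sup>2"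
    proof -
      have "z r * w' r - w r * z' r = (z r)\<^sup>2 / \<rho> r + \<mu> * \<rho> r * (w r)\<^sup>2"
        using w'[of r] z'[of r] r r' by (auto simp: power2_eq_square)
      also have "\<dots> = ((sin (?\<phi> r))\<^sup>2 / \<rho> r + \<mu> * \<rho> r * (cos (?\<phi> r))\<^sup>2) * B\<^sup>2"
        unfolding k B_def[symmetric] by (simp add: power_mult_distrib algebra_simps)
      finally show ?thesis
        unfolding rotation_rate_def N1 using AB by simp
    qed
    let ?d = "(sin (?\<theta> r))\<^sup>2 - (sin (?\<phi> r))\<^sup>2"
    have "(1 / \<rho> r - \<mu> * \<rho> r) * ?d \<le> rotation_rate x y x' y' r - rotation_rate w z w' z' r"
    proof -
      have "(1 / \<rho> r - \<mu> * \<rho> r) * ?d = (sin (?\<theta> r))\<^sup>2 / \<rho> r + \<mu> * \<rho> r * (cos (?\<theta> r))\<^sup>2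
          - ((sin (?\<phi> r))\<^sup>2 / \<rho> r + \<mu> * \<rho> r * (cos (?\<phi> r))\<^sup>2)"
        unfolding cos_squared_eq by (simp add: algebra_simps diff_divide_distrib)
      then show ?thesis using rate1 rate2 by linarith
    qed
    moreover have "\<bar>(1 / \<rho> r - \<mu> * \<rho> r) * ?d\<bar> \<le> ?C * \<bar>?\<theta> r - ?\<phi> r\<bar>"
      unfolding abs_mult
    proof (rule mult_mono[OF _ abs_sin_sq_diff_le])
      have "1 / \<rho> r \<le> 1 / \<rho> r0" "\<mu> * \<rho> r \<le> \<mu> * \<rho> b" "0 \<le> 1 / \<rho> r" "0 \<le> \<mu> * \<rho> r"
        using rp \<mu> by (auto intro!: divide_left_mono mult_left_mono)
      then show "\<bar>1 / \<rho> r - \<mu> * \<rho> r\<bar> \<le> ?C" by linarith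
      show "0 \<le> ?C" using rp \<mu> by auto
    qed auto
    ultimately show "- (?C * \<bar>?\<theta> r - ?\<phi> r\<bar>) \<le> rotation_rate x y x' y' r - rotation_rate w z w' z' r"
      by linarith
  qed (use r0 D0 in auto)
  then show ?thesis by simp
qed

lemma planar_curve_neg:
  assumes "planar_curve a b x y x' y'"
  shows "planar_curve a b (\<lambda>r. - x r) (\<lambda>r. - y r) (\<lambda>r. - x' r) (\<lambda>r. - y' r)"
    and "rotation_angle a (\<lambda>r. - x r) (\<lambda>r. - y r) (\<lambda>r. - x' r) (\<lambda>r. - y' r) = rotation_angle a x y x' y'"
  using assms
  by (auto simp: planar_curve_def rotation_angle_def[abs_def] rotation_rate_def[abs_def]
      intro!: continuous_intros derivative_intros)

text \<open>Reflection at the origin changes neither the angle nor the hypotheses, which disposes of the signs at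
a.\<close>

lemma sturm_angle_comparison:
  fixes x y x' y' w z w' z' \<rho> :: "real \<Rightarrow> real"
  assumes pc: "planar_curve a b x y x' y'" and pl: "planar_curve a b w z w' z'"
    and rho_pos: "\<And>r. a < r \<Longrightarrow> r \<le> b \<Longrightarrow> 0 < \<rho> r"
    and rho_mono: "\<And>s t. a \<le> s \<Longrightarrow> s \<le> t \<Longrightarrow> t \<le> b \<Longrightarrow> \<rho> s \<le> \<rho> t"
    and \<mu>: "0 \<le> \<mu>" "\<mu> < c"
    and w': "\<And>r. a < r \<Longrightarrow> r < b \<Longrightarrow> w' r = z r / \<rho> r"
    and z': "\<And>r. a < r \<Longrightarrow> r < b \<Longrightarrow> z' r = - (\<mu> * \<rho> r * w r)"
    and x': "\<And>r. a < r \<Longrightarrow> r < b \<Longrightarrow> (y r)\<^sup>2 / \<rho> r \<le> y r * x' r"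
    and y': "\<And>r. a < r \<Longrightarrow> r < b \<Longrightarrow> c * \<rho> r * (x r)\<^sup>2 \<le> - (x r * y' r)"
  shows "rotation_angle a w z w' z' b < rotation_angle a x y x' y' b"
proof -
  have x_case: "rotation_angle a W Z W' Z' b < rotation_angle a x y x' y' b"
    if pl: "planar_curve a b W Z W' Z'" and W': "\<And>r. a < r \<Longrightarrow> r < b \<Longrightarrow> W' r = Z r / \<rho> r"
    and Z': "\<And>r. a < r \<Longrightarrow> r < b \<Longrightarrow> Z' r = - (\<mu> * \<rho> r * W r)" and Wa: "0 < W a"
    for W Z W' Z'
  proof (cases "0 < x a")
    case True
    show ?thesis
      by (rule sturm_angle_comparison_pos[OF pc pl rho_pos rho_mono \<mu> W' Z' x' y' True Wa])
  next
    case False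
    then have xa: "0 < - x a" using planar_curve_start[OF pc] by simp
    show ?thesis
      unfolding planar_curve_neg(2)[OF pc, symmetric]
      by (rule sturm_angle_comparison_pos[OF planar_curve_neg(1)[OF pc] pl rho_pos rho_mono \<mu> W' Z' _ _ _ Wa])
         (use x' y' xa in auto)
  qed
  show ?thesis
  proof (cases "0 < w a")
    case True
    show ?thesis by (rule x_case[OF pl w' z' True])
  next
    case False
    then have wa: "0 < - w a" using planar_curve_start[OF pl] by simp
    show ?thesis
      unfolding planar_curve_neg(2)[OF pl, symmetric]
      by (rule x_case[OF planar_curve_neg(1)[OF pl]]) (use w' z' wa in auto)
  qed
qed

section \<open>Radial functions as solutions of the boundary value problem\<close>

definition radial_domain :: "real \<Rightarrow> real \<Rightarrow> 'a::euclidean_space set \<Rightarrow> bool" where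
  "radial_domain R1 R2 \<Omega> \<longleftrightarrow>
     (0 < R1 \<and> R1 < R2 \<and> \<Omega> = {x. R1 < norm x \<and> norm x < R2}) \<or>
     (R1 = 0 \<and> 0 < R2 \<and> \<Omega> = {x. norm x < R2})"

lemma radial_domain_open: "radial_domain R1 R2 \<Omega> \<Longrightarrow> open \<Omega>"
  by (auto simp: radial_domain_def intro!: open_Collect_conj open_Collect_less continuous_intros)

lemma radial_domain_closure:
  assumes "radial_domain R1 R2 \<Omega>"
  shows "closure \<Omega> \<subseteq> {x. R1 \<le> norm x \<and> norm x \<le> R2}"
proof (rule closure_minimal)
  show "closed {x::'a. R1 \<le> norm x \<and> norm x \<le> R2}"
    by (intro closed_Collect_conj closed_Collect_le continuous_intros)
qed (use assms in \<open>auto simp: radial_domain_def\<close>)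

lemma radial_domain_frontier:
  assumes "radial_domain R1 R2 \<Omega>" "x \<in> frontier \<Omega>"
  shows "(norm x = R1 \<and> 0 < R1) \<or> norm x = R2"
proof -
  have "x \<in> closure \<Omega>" "x \<notin> \<Omega>"
    using assms(2) interior_open[OF radial_domain_open[OF assms(1)]] by (auto simp: frontier_def)
  then have "R1 \<le> norm x" "norm x \<le> R2" "x \<notin> \<Omega>"
    using radial_domain_closure[OF assms(1)] by auto
  then show ?thesis using assms(1) by (auto simp: radial_domain_def)
qed

lemma radial_domain_cases:
  assumes "radial_domain R1 R2 \<Omega>" "x \<in> \<Omega>"
  shows "x = 0 \<and> R1 = 0 \<or> x \<noteq> 0 \<and> R1 < norm x \<and> norm x < R2"
  using assms by (auto simp: radial_domain_def)

text \<open>The coefficient of x in the field h(|x|) x/|x|. The value c at the origin is meant to be h'(0).\<close>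

definition radial_quotient :: "(real \<Rightarrow> real) \<Rightarrow> real \<Rightarrow> real \<Rightarrow> real" where
  "radial_quotient h c r = (if r = 0 then c else h r / r)"

text \<open>The derivative of x \<mapsto> h(|x|) x/|x| acts as h'(r) in the radial direction and as h(r)/r in the
tangential ones. At the origin the convention \<open>sgn 0 = 0\<close> leaves h'(0) times the identity.\<close>

definition radial_jacobian :: "(real \<Rightarrow> real) \<Rightarrow> (real \<Rightarrow> real) \<Rightarrow> 'a::euclidean_space \<Rightarrow> 'a \<Rightarrow>\<^sub>L 'a" where
  "radial_jacobian h h' x =
     radial_quotient h (h' 0) (norm x) *\<^sub>R id_blinfun +
     (h' (norm x) - radial_quotient h (h' 0) (norm x)) *\<^sub>R (blinfun_scaleR_left (sgn x) o\<^sub>L blinfun_inner_left (sgn x))"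

text \<open>The profiles h for which the radial field h(|x|) x/|x| is continuously differentiable up to the
boundary. If the origin belongs to the domain, h(0) = 0 is needed for the field to be continuous there.\<close>

definition smooth_profile :: "real \<Rightarrow> real \<Rightarrow> (real \<Rightarrow> real) \<Rightarrow> (real \<Rightarrow> real) \<Rightarrow> bool" where
  "smooth_profile R1 R2 h h' \<longleftrightarrow> 0 \<le> R1 \<and> R1 < R2 \<and>
     continuous_on {R1..R2} h \<and> continuous_on {R1..R2} h' \<and>
     (\<forall>r\<in>{R1<..<R2}. (h has_real_derivative h' r) (at r)) \<and>
     (R1 = 0 \<longrightarrow> h 0 = 0 \<and> (h has_real_derivative h' 0) (at 0 within {0..R2}))"

lemma radial_quotient_cont:
  assumes R1: "0 \<le> R1" and h: "continuous_on {R1..R2} h"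
    and h0: "R1 = 0 \<Longrightarrow> h 0 = 0 \<and> (h has_real_derivative c) (at 0 within {0..R2})"
  shows "continuous_on {R1..R2} (radial_quotient h c)"
proof -
  have "continuous (at r within {R1..R2}) (radial_quotient h c)" if r: "r \<in> {R1..R2}" for r
  proof (cases "r = 0")
    case True
    then have "R1 = 0" using r R1 by auto
    then have "((\<lambda>x. (h x - h 0) / (x - 0)) \<longlongrightarrow> c) (at 0 within {R1..R2})" "h 0 = 0"
      using h0 by (auto simp: has_field_derivative_iff)
    then have "(radial_quotient h c \<longlongrightarrow> c) (at 0 within {R1..R2})"
      by (elim Lim_transform_eventually) (auto simp: eventually_at_filter radial_quotient_def)
    then show ?thesis using True by (simp add: continuous_within radial_quotient_def)
  next
    case False
    have "continuous (at r within {R1..R2}) (\<lambda>r. h r / r)"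
      using h r False by (auto simp: continuous_on_eq_continuous_within intro!: continuous_intros)
    then show ?thesis
      by (rule continuous_transform_within[of _ _ _ "\<bar>r\<bar>"])
         (use False r in \<open>auto simp: radial_quotient_def dist_real_def\<close>)
  qed
  then show ?thesis by (simp add: continuous_on_eq_continuous_within)
qed

lemma smooth_profile_quotient_cont:
  "smooth_profile R1 R2 h h' \<Longrightarrow> continuous_on {R1..R2} (radial_quotient h (h' 0))"
  by (rule radial_quotient_cont) (auto simp: smooth_profile_def)

text \<open>At the origin the rank one projection y \<mapsto> (y \<cdot> x/|x|) x/|x| has no limit, but its norm is at most 1 and its
coefficient h' - h/r tends to 0.\<close>

lemma radial_jacobian_cont:
  assumes sp: "smooth_profile R1 R2 h h'"
  shows "continuous_on {x::'a::euclidean_space. R1 \<le> norm x \<and> norm x \<le> R2} (radial_jacobian h h')"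
proof -
  let ?S = "{x::'a. R1 \<le> norm x \<and> norm x \<le> R2}"
  let ?A = "\<lambda>x::'a. radial_quotient h (h' 0) (norm x)"
  let ?B = "\<lambda>x::'a. h' (norm x) - ?A x"
  let ?P = "\<lambda>s::'a. blinfun_scaleR_left s o\<^sub>L blinfun_inner_left s"
  have A: "continuous_on ?S ?A"
    by (rule continuous_on_compose2[OF smooth_profile_quotient_cont[OF sp]]) (auto intro!: continuous_intros)
  have "continuous_on {R1..R2} h'" using sp by (simp add: smooth_profile_def)
  then have "continuous_on ?S (\<lambda>x. h' (norm x))"
    by (rule continuous_on_compose2) (auto intro!: continuous_intros)
  then have B: "continuous_on ?S ?B" by (intro continuous_intros A)
  have bound: "norm (?P (sgn x)) \<le> 1" for x
  proof (rule norm_blinfun_bound)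
    fix y
    have "norm (blinfun_apply (?P (sgn x)) y) = \<bar>y \<bullet> sgn x\<bar> * norm (sgn x)" by simp
    also have "\<dots> \<le> (norm y * norm (sgn x)) * norm (sgn x)"
      by (intro mult_right_mono Cauchy_Schwarz_ineq2) auto
    also have "\<dots> \<le> 1 * norm y" by (simp add: norm_sgn)
    finally show "norm (blinfun_apply (?P (sgn x)) y) \<le> 1 * norm y" .
  qed simp
  have "continuous (at x within ?S) (\<lambda>x. ?B x *\<^sub>R ?P (sgn x))" if x: "x \<in> ?S" for x
  proof (cases "x = 0")
    case True
    have B0: "?B 0 = 0" by (simp add: radial_quotient_def)
    have "continuous (at x within ?S) ?B" using B x by (simp only: continuous_on_eq_continuous_within)
    then have lim: "(?B \<longlongrightarrow> 0) (at 0 within ?S)" by (simp only: continuous_within True B0)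
    have "((\<lambda>x. ?B x *\<^sub>R ?P (sgn x)) \<longlongrightarrow> 0) (at 0 within ?S)"
    proof (rule Lim_null_comparison)
      show "((\<lambda>x. norm (?B x)) \<longlongrightarrow> 0) (at 0 within ?S)" using lim by (rule tendsto_norm_zero)
      have "norm (?B y *\<^sub>R ?P (sgn y)) \<le> norm (?B y)" for y
        using mult_left_mono[OF bound[of y], of "\<bar>?B y\<bar>"] by simp
      then show "\<forall>\<^sub>F y in at 0 within ?S. norm (?B y *\<^sub>R ?P (sgn y)) \<le> norm (?B y)"
        by (intro always_eventually allI)
    qed
    then show ?thesis by (simp only: continuous_within True B0 scaleR_zero_left)
  next
    case False
    have "continuous (at x within ?S) ?B" using B x by (simp add: continuous_on_eq_continuous_within)
    moreover have "continuous (at x within ?S) (\<lambda>x. sgn x)"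
      unfolding sgn_div_norm using False by (intro continuous_intros) auto
    moreover have "continuous (at x within ?S) (\<lambda>x. ?P (sgn x))"
      using calculation(2)
      by (intro bounded_bilinear.continuous[OF bounded_bilinear_blinfun_compose]
          bounded_linear.continuous[OF bounded_linear_blinfun_scaleR_left]
          bounded_linear.continuous[OF bounded_linear_blinfun_inner_left])
    ultimately show ?thesis by (intro continuous_scaleR)
  qed
  then have "continuous_on ?S (\<lambda>x. ?B x *\<^sub>R ?P (sgn x))"
    by (simp add: continuous_on_eq_continuous_within)
  then show ?thesis unfolding radial_jacobian_def[abs_def]
    by (rule continuous_on_add[OF continuous_on_scaleR[OF A continuous_on_const]])
qed

lemma radial_field_cont:
  assumes sp: "smooth_profile R1 R2 h h'"
  shows "continuous_on {x::'a::euclidean_space. R1 \<le> norm x \<and> norm x \<le> R2} (\<lambda>x. h (norm x) *\<^sub>R sgn x)"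
proof -
  have "continuous_on {x::'a. R1 \<le> norm x \<and> norm x \<le> R2} (\<lambda>x. radial_quotient h (h' 0) (norm x) *\<^sub>R x)"
    by (intro continuous_intros continuous_on_compose2[OF smooth_profile_quotient_cont[OF sp]]) auto
  moreover have "radial_quotient h (h' 0) (norm x) *\<^sub>R x = h (norm x) *\<^sub>R sgn x" for x :: 'a
    by (auto simp: radial_quotient_def sgn_div_norm divide_inverse)
  ultimately show ?thesis by simp
qed

lemma radial_field_deriv:
  fixes x :: "'a::euclidean_space"
  assumes dom: "radial_domain R1 R2 \<Omega>" and sp: "smooth_profile R1 R2 h h'" and x: "x \<in> \<Omega>"
  shows "((\<lambda>x. h (norm x) *\<^sub>R sgn x) has_derivative blinfun_apply (radial_jacobian h h' x)) (at x)"
  using radial_domain_cases[OF dom x]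
proof
  assume x0: "x = 0 \<and> R1 = 0"
  have "((\<lambda>y::'a. h (norm y) *\<^sub>R sgn y) has_derivative (\<lambda>y. h' 0 *\<^sub>R y)) (at 0)"
    unfolding has_derivative_iff_norm
  proof
    have op: "open {x::'a. norm x < R2}" by (intro open_Collect_less continuous_intros)
    have R2: "0 < R2" using sp x0 by (simp add: smooth_profile_def)
    have "continuous_on {x::'a. norm x < R2} (\<lambda>y. radial_quotient h (h' 0) (norm y))"
      by (rule continuous_on_compose2[OF smooth_profile_quotient_cont[OF sp]]) (auto intro!: continuous_intros simp: x0)
    then have "isCont (\<lambda>y::'a. radial_quotient h (h' 0) (norm y)) 0"
      using op R2 by (simp add: continuous_on_eq_continuous_at)
    then have "((\<lambda>y::'a. radial_quotient h (h' 0) (norm y)) \<longlongrightarrow> h' 0) (at 0)"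
      by (simp add: isCont_def radial_quotient_def)
    then have "((\<lambda>y::'a. \<bar>radial_quotient h (h' 0) (norm y) - h' 0\<bar>) \<longlongrightarrow> 0) (at 0)"
      using tendsto_rabs_zero[OF LIM_zero] by blast
    moreover have "\<bar>radial_quotient h (h' 0) (norm y) - h' 0\<bar> =
        norm (h (norm y) *\<^sub>R sgn y - h (norm 0) *\<^sub>R sgn 0 - h' 0 *\<^sub>R (y - 0)) / norm (y - 0)" if "y \<noteq> 0" for y :: 'a
    proof -
      have "h (norm y) *\<^sub>R sgn y - h (norm 0) *\<^sub>R sgn 0 - h' 0 *\<^sub>R (y - 0) = (radial_quotient h (h' 0) (norm y) - h' 0) *\<^sub>R y"
        using that by (simp add: radial_quotient_def sgn_div_norm divide_inverse scaleR_left_diff_distrib)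
      then show ?thesis using that by simp
    qed
    ultimately show "((\<lambda>y::'a. norm (h (norm y) *\<^sub>R sgn y - h (norm 0) *\<^sub>R sgn 0 - h' 0 *\<^sub>R (y - 0)) / norm (y - 0)) \<longlongrightarrow> 0) (at 0)"
      by (elim Lim_transform_eventually) (auto simp: eventually_at_filter)
  qed (rule bounded_linear_scaleR_right)
  moreover have "blinfun_apply (radial_jacobian h h' x) = (\<lambda>y. h' 0 *\<^sub>R y)"
    using x0 by (auto simp: radial_jacobian_def radial_quotient_def blinfun.bilinear_simps)
  ultimately show ?thesis using x0 by simp
next
  assume x1: "x \<noteq> 0 \<and> R1 < norm x \<and> norm x < R2"
  have hd: "(h has_real_derivative h' (norm x)) (at (norm x))"
    using sp x1 by (simp add: smooth_profile_def)
  have nd: "(norm has_derivative (\<lambda>y. y \<bullet> sgn x)) (at x)"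
    using has_derivative_norm x1 by blast
  have qd: "((\<lambda>r. h r / r) has_real_derivative (h' (norm x) * norm x - h (norm x)) / (norm x * norm x)) (at (norm x))"
    using x1 by (auto intro!: derivative_eq_intros hd)
  have "((\<lambda>y. h (norm y) / norm y) has_derivative
      (\<lambda>y. (y \<bullet> sgn x) * ((h' (norm x) * norm x - h (norm x)) / (norm x * norm x)))) (at x)"
    using has_derivative_compose[OF nd qd[unfolded has_field_derivative_def]]
    by (simp only: mult.commute)
  then have "((\<lambda>y. (h (norm y) / norm y) *\<^sub>R y) has_derivative
      (\<lambda>y. (h (norm x) / norm x) *\<^sub>R y + ((y \<bullet> sgn x) * ((h' (norm x) * norm x - h (norm x)) / (norm x * norm x))) *\<^sub>R x)) (at x)"
    by (rule has_derivative_scaleR[OF _ has_derivative_ident])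
  moreover have "(\<lambda>y. (h (norm x) / norm x) *\<^sub>R y + ((y \<bullet> sgn x) * ((h' (norm x) * norm x - h (norm x)) / (norm x * norm x))) *\<^sub>R x)
     = blinfun_apply (radial_jacobian h h' x)"
  proof
    fix y
    let ?c = "(h' (norm x) * norm x - h (norm x)) / (norm x * norm x)" and ?d = "h' (norm x) - h (norm x) / norm x"
    have "?c = ?d * inverse (norm x)" using x1 by (simp add: field_simps)
    then have c: "?c *\<^sub>R x = ?d *\<^sub>R sgn x" by (simp only: sgn_div_norm scaleR_scaleR)
    have "((y \<bullet> sgn x) * ?c) *\<^sub>R x = (y \<bullet> sgn x) *\<^sub>R (?c *\<^sub>R x)" by (simp only: scaleR_scaleR)
    also have "\<dots> = ?d *\<^sub>R (y \<bullet> sgn x) *\<^sub>R sgn x" unfolding c by (rule scaleR_left_commute)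
    finally have "((y \<bullet> sgn x) * ?c) *\<^sub>R x = ?d *\<^sub>R (y \<bullet> sgn x) *\<^sub>R sgn x" .
    then show "(h (norm x) / norm x) *\<^sub>R y + ((y \<bullet> sgn x) * ((h' (norm x) * norm x - h (norm x)) / (norm x * norm x))) *\<^sub>R x
        = blinfun_apply (radial_jacobian h h' x) y"
      using x1 by (simp add: radial_jacobian_def radial_quotient_def blinfun.bilinear_simps)
  qed
  moreover have "(\<lambda>y::'a. (h (norm y) / norm y) *\<^sub>R y) = (\<lambda>y. h (norm y) *\<^sub>R sgn y)"
    by (auto simp: sgn_div_norm divide_inverse)
  ultimately show ?thesis by simp
qed

lemma radial_jacobian_trace:
  "(\<Sum>b\<in>Basis. blinfun_apply (radial_jacobian h h' (x::'a::euclidean_space)) b \<bullet> b)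
       = h' (norm x) + real (DIM('a) - 1) * radial_quotient h (h' 0) (norm x)"
proof -
  let ?A = "radial_quotient h (h' 0) (norm x)"
  define n where "n = real (DIM('a) - 1)"
  have D: "real (DIM('a)) = n + 1"
    using DIM_positive[where 'a='a] by (simp add: of_nat_diff n_def)
  have "(\<Sum>b\<in>Basis. blinfun_apply (radial_jacobian h h' x) b \<bullet> b)
     = (\<Sum>b\<in>Basis. ?A * (b \<bullet> b) + (h' (norm x) - ?A) * ((b \<bullet> sgn x) * (sgn x \<bullet> b)))"
    by (simp add: radial_jacobian_def blinfun.bilinear_simps inner_add_left mult.assoc)
  also have "\<dots> = ?A * DIM('a) + (h' (norm x) - ?A) * (sgn x \<bullet> sgn x)"
    by (simp add: sum.distrib sum_distrib_left[symmetric] euclidean_inner[of "sgn x" "sgn x"] inner_commute)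
  also have "\<dots> = h' (norm x) + n * ?A"
  proof (cases "x = 0")
    case True
    then show ?thesis unfolding D by (simp add: radial_quotient_def algebra_simps)
  next
    case False
    then have "sgn x \<bullet> sgn x = 1" by (simp add: dot_square_norm norm_sgn)
    then show ?thesis unfolding D by (simp add: algebra_simps)
  qed
  finally show ?thesis by (simp only: n_def)
qed

lemma radial_GDERIV:
  fixes x :: "'a::euclidean_space"
  assumes dom: "radial_domain R1 R2 \<Omega>" and x: "x \<in> \<Omega>"
    and v: "\<And>r. r \<in> {R1..R2} \<Longrightarrow> (v has_real_derivative h r) (at r within {R1..R2})" and h0: "h R1 = 0"
  shows "GDERIV (\<lambda>x. v (norm x)) x :> h (norm x) *\<^sub>R sgn x"
  using radial_domain_cases[OF dom x]
proof
  assume x1: "x \<noteq> 0 \<and> R1 < norm x \<and> norm x < R2"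
  then have "at (norm x) within {R1..R2} = at (norm x)" by (auto intro!: at_within_interior)
  then have "(v has_real_derivative h (norm x)) (at (norm x))" using v[of "norm x"] x1 by simp
  then show ?thesis using GDERIV_DERIV_compose[OF GDERIV_norm] x1 by blast
next
  assume x0: "x = 0 \<and> R1 = 0"
  have R2: "0 < R2" using dom x0 by (auto simp: radial_domain_def)
  have "(v has_real_derivative 0) (at 0 within {0..R2})" using v[of 0] h0 x0 R2 by simp
  then have l: "((\<lambda>r. (v r - v 0) / r) \<longlongrightarrow> 0) (at 0 within {0..R2})"
    by (simp add: has_field_derivative_iff)
  have "filterlim (norm :: 'a \<Rightarrow> real) (at 0 within {0..R2}) (at 0)"
  proof -
    have "\<forall>\<^sub>F y::'a in at 0. dist y 0 < R2 \<and> y \<noteq> 0" using R2 unfolding eventually_at by auto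
    then have "\<forall>\<^sub>F y::'a in at 0. norm y \<in> {0..R2} \<and> norm y \<noteq> 0" by eventually_elim auto
    moreover have "((norm :: 'a \<Rightarrow> real) \<longlongrightarrow> 0) (at 0)" by (rule tendsto_norm_zero[OF tendsto_ident_at])
    ultimately show ?thesis by (simp add: filterlim_at)
  qed
  from filterlim_compose[OF l this]
  have "((\<lambda>y::'a. \<bar>(v (norm y) - v 0) / norm y\<bar>) \<longlongrightarrow> 0) (at 0)" by (rule tendsto_rabs_zero)
  then have "((\<lambda>y::'a. v (norm y)) has_derivative (\<lambda>y. 0)) (at 0)"
    unfolding has_derivative_iff_norm by (simp add: abs_divide)
  then show ?thesis using x0 by (simp add: gderiv_def)
qed

lemma gradient_eq: "GDERIV u x :> g \<Longrightarrow> gradient u x = g"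
proof -
  assume "GDERIV u x :> g"
  then have "(\<lambda>h. h \<bullet> g) = frechet_derivative u (at x)"
    unfolding gderiv_def by (rule frechet_derivative_at)
  then show ?thesis
    unfolding gradient_def using euclidean_representation[of g] by (metis (no_types, lifting) inner_commute sum.cong)
qed

text \<open>At both boundary components the norm is an affine function of t along the normal line, with slope
\<sigma> = -1 on the inner and \<sigma> = 1 on the outer sphere.\<close>

lemma normal_derivative_zero:
  fixes x :: "'a::euclidean_space"
  assumes R: "0 \<le> R1" "R1 < R2" and x: "(norm x = R1 \<and> 0 < R1) \<or> norm x = R2"
    and v1: "(v has_real_derivative 0) (at R1 within {R1..R2})"
    and v2: "(v has_real_derivative 0) (at R2 within {R1..R2})"
  shows "((\<lambda>t. v (norm (x + t *\<^sub>R outer_normal R1 x))) has_real_derivative 0) (at_left 0)"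
proof -
  let ?I = "{- (R2 - R1)..0}"
  define \<sigma> where "\<sigma> = (if norm x = R1 then -1 else 1 :: real)"
  have x0: "x \<noteq> 0" using x R by auto
  have nrm: "norm (x + t *\<^sub>R outer_normal R1 x) = norm x + \<sigma> * t" if t: "t \<in> ?I" for t
  proof -
    have "x = norm x *\<^sub>R sgn x" using x0 by (simp add: sgn_div_norm)
    then have "x + t *\<^sub>R outer_normal R1 x = (norm x + \<sigma> * t) *\<^sub>R sgn x"
      by (auto simp: outer_normal_def \<sigma>_def algebra_simps)
    moreover have "0 \<le> norm x + \<sigma> * t" using t x R by (auto simp: \<sigma>_def)
    ultimately show ?thesis using x0 by (simp add: norm_sgn)
  qed
  have "(v has_real_derivative 0) (at (norm x) within {R1..R2})" using x v1 v2 by auto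
  moreover have "(\<lambda>t. norm x + \<sigma> * t) ` ?I \<subseteq> {R1..R2}"
    using x R by (auto simp: \<sigma>_def)
  ultimately have "(v has_real_derivative 0) (at (norm x) within (\<lambda>t. norm x + \<sigma> * t) ` ?I)"
    by (rule DERIV_subset)
  then have "(v has_real_derivative 0) (at (norm x + \<sigma> * 0) within (\<lambda>t. norm x + \<sigma> * t) ` ?I)"
    by simp
  then have "((v \<circ> (\<lambda>t. norm x + \<sigma> * t)) has_real_derivative 0 * \<sigma>) (at 0 within ?I)"
    by (rule DERIV_image_chain) (auto intro!: derivative_eq_intros)
  from has_field_derivative_transform_within[OF this zero_less_one]
  have "((\<lambda>t. v (norm (x + t *\<^sub>R outer_normal R1 x))) has_real_derivative 0 * \<sigma>) (at 0 within ?I)"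
    using R nrm by simp
  then show ?thesis using R by (simp add: at_within_Icc_at_left)
qed

text \<open>The inverse of s \<mapsto> s/sqrt(1-s^2). Since its values lie in (-1,1), prescribing
u' as the minkowski_slope of the flux makes |\<nabla> u| < 1 automatic.\<close>

definition minkowski_slope :: "real \<Rightarrow> real" where
  "minkowski_slope p = p / sqrt (1 + p\<^sup>2)"

lemma minkowski_slope_bound: "\<bar>minkowski_slope p\<bar> < 1"
proof -
  have "\<bar>p\<bar> < sqrt (1 + p\<^sup>2)" by (rule real_less_rsqrt) simp
  moreover have "0 < sqrt (1 + p\<^sup>2)" by (simp add: add_pos_nonneg)
  ultimately show ?thesis by (simp add: minkowski_slope_def abs_divide divide_less_eq)
qed

lemma minkowski_slope_0 [simp]: "minkowski_slope 0 = 0"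
  by (simp add: minkowski_slope_def)

lemma minkowski_slope_deriv:
  "(minkowski_slope has_real_derivative 1 / ((1 + p\<^sup>2) * sqrt (1 + p\<^sup>2))) (at p)"
proof -
  have p: "0 < 1 + p\<^sup>2" by (simp add: add_pos_nonneg)
  have "(minkowski_slope has_real_derivative
      (sqrt (1 + p\<^sup>2) - p * (2 * p * (inverse (sqrt (1 + p\<^sup>2)) / 2))) / (sqrt (1 + p\<^sup>2) * sqrt (1 + p\<^sup>2))) (at p)"
    unfolding minkowski_slope_def[abs_def] using p
    by (auto intro!: derivative_eq_intros)
  moreover have "(sqrt (1 + p\<^sup>2) - p * (2 * p * (inverse (sqrt (1 + p\<^sup>2)) / 2))) / (sqrt (1 + p\<^sup>2) * sqrt (1 + p\<^sup>2))
      = 1 / ((1 + p\<^sup>2) * sqrt (1 + p\<^sup>2))"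
  proof -
    define s where "s = sqrt (1 + p\<^sup>2)"
    have s: "s * s = 1 + p\<^sup>2" "0 < s" using p by (auto simp: s_def)
    have "s - p * (2 * p * (inverse s / 2)) = (s * s - p\<^sup>2) / s"
      using s(2) by (simp add: field_simps power2_eq_square)
    then show ?thesis unfolding s_def[symmetric] using s by simp
  qed
  ultimately show ?thesis by simp
qed

lemma minkowski_slope_inverse:
  "minkowski_slope p / sqrt (1 - (minkowski_slope p)\<^sup>2) = p"
proof -
  have p: "0 < 1 + p\<^sup>2" by (simp add: add_pos_nonneg)
  have "1 - (minkowski_slope p)\<^sup>2 = 1 / (1 + p\<^sup>2)"
    using p by (simp add: minkowski_slope_def power_divide field_simps)
  then show ?thesis using p by (simp add: minkowski_slope_def real_sqrt_divide)
qed

text \<open>The gradient of v(|x|) is the radial field with profile v' = p/sqrt(1+p^2), and the Minkowski flux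
is the radial field with profile p itself, whose divergence is p' + (N-1)p/r. At the origin the
equation forces p'(0) = -f(v(0))/N, which is also what makes p' continuous there.\<close>

lemma neumann_solution_of_radial:
  fixes \<Omega> :: "'a::euclidean_space set"
  assumes dom: "radial_domain R1 R2 \<Omega>"
    and v: "\<And>r. r \<in> {R1..R2} \<Longrightarrow> (v has_real_derivative minkowski_slope (p r)) (at r within {R1..R2})"
    and p_cont: "continuous_on {R1..R2} p"
    and p_deriv: "\<And>r. r \<in> {R1<..<R2} \<Longrightarrow>
          (p has_real_derivative - f (v r) - real (DIM('a) - 1) / r * p r) (at r)"
    and p_zero: "R1 = 0 \<Longrightarrow> (p has_real_derivative - f (v 0) / DIM('a)) (at 0 within {0..R2})"
    and p_ends: "p R1 = 0" "p R2 = 0"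
    and f_cont: "continuous_on {R1..R2} (\<lambda>r. f (v r))"
    and v_pos: "\<And>r. r \<in> {R1..R2} \<Longrightarrow> 0 < v r"
  shows "neumann_solution \<Omega> (outer_normal R1) f (\<lambda>x. v (norm x))"
proof -
  have R: "0 \<le> R1" "R1 < R2" using dom by (auto simp: radial_domain_def)
  define n where "n = real (DIM('a) - 1)"
  have D: "real (DIM('a)) = n + 1" and n0: "0 \<le> n"
    using DIM_positive[where 'a='a] by (auto simp: of_nat_diff n_def)
  define p' where "p' r = - f (v r) - n * radial_quotient p (- f (v 0) / DIM('a)) r" for r
  have p'0: "p' 0 = - f (v 0) / DIM('a)"
    using n0 by (simp add: p'_def radial_quotient_def D field_simps)
  have spp: "smooth_profile R1 R2 p p'"
    unfolding smooth_profile_def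
  proof (intro conjI ballI impI)
    fix r assume "r \<in> {R1<..<R2}"
    then show "(p has_real_derivative p' r) (at r)"
      using p_deriv[of r] R by (auto simp: p'_def n_def radial_quotient_def)
  next
    have "continuous_on {R1..R2} (radial_quotient p (- f (v 0) / DIM('a)))"
      by (rule radial_quotient_cont[OF R(1) p_cont]) (use p_zero p_ends in auto)
    then show "continuous_on {R1..R2} p'" unfolding p'_def[abs_def] by (intro continuous_intros f_cont)
  next
    assume "R1 = 0"
    then show "p 0 = 0" "(p has_real_derivative p' 0) (at 0 within {0..R2})"
      using p_ends p_zero p'0 by auto
  qed (use R p_cont in auto)
  define h where "h r = minkowski_slope (p r)" for r
  define h' where "h' r = 1 / ((1 + (p r)\<^sup>2) * sqrt (1 + (p r)\<^sup>2)) * p' r" for r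
  have sph: "smooth_profile R1 R2 h h'"
    unfolding smooth_profile_def
  proof (intro conjI ballI impI)
    show "continuous_on {R1..R2} h" unfolding h_def
      by (rule continuous_on_compose2[OF DERIV_continuous_on[of UNIV minkowski_slope] p_cont])
         (auto intro!: minkowski_slope_deriv)
    have "1 + (p r)\<^sup>2 \<noteq> 0" for r using add_pos_nonneg[OF zero_less_one zero_le_power2[of "p r"]] by simp
    then show "continuous_on {R1..R2} h'"
      unfolding h'_def using spp by (intro continuous_intros p_cont) (auto simp: smooth_profile_def)
    fix r assume "r \<in> {R1<..<R2}"
    then have "(p has_real_derivative p' r) (at r)" using spp by (simp add: smooth_profile_def)
    then show "(h has_real_derivative h' r) (at r)"
      unfolding h_def h'_def by (rule DERIV_chain2[OF minkowski_slope_deriv])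
  next
    assume "R1 = 0"
    then have "(p has_real_derivative p' 0) (at 0 within {0..R2})" using spp by (simp add: smooth_profile_def)
    then show "(h has_real_derivative h' 0) (at 0 within {0..R2})"
      unfolding h_def h'_def by (rule DERIV_chain2[OF minkowski_slope_deriv])
    show "h 0 = 0" using \<open>R1 = 0\<close> p_ends by (simp add: h_def)
  qed (use R in auto)
  have hR: "h R1 = 0" "h R2 = 0" using p_ends by (auto simp: h_def)
  have vh: "\<And>r. r \<in> {R1..R2} \<Longrightarrow> (v has_real_derivative h r) (at r within {R1..R2})"
    using v by (simp add: h_def)
  let ?u = "\<lambda>x::'a. v (norm x)" and ?G = "\<lambda>x::'a. h (norm x) *\<^sub>R sgn x"
  have G: "GDERIV ?u x :> ?G x" if "x \<in> \<Omega>" for x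
    using radial_GDERIV[OF dom that vh hR(1)] .
  have grad: "gradient ?u x = ?G x" if "x \<in> \<Omega>" for x
    by (rule gradient_eq[OF G[OF that]])
  have cl: "closure \<Omega> \<subseteq> {x. R1 \<le> norm x \<and> norm x \<le> R2}" by (rule radial_domain_closure[OF dom])
  have nG: "norm (?G x) < 1" for x
    using minkowski_slope_bound[of "p (norm x)"] by (auto simp: h_def norm_sgn)
  have flux: "gradient ?u y /\<^sub>R sqrt (1 - (norm (gradient ?u y))\<^sup>2) = p (norm y) *\<^sub>R sgn y" if "y \<in> \<Omega>" for y
  proof (cases "y = 0")
    case False
    then have nG: "norm (?G y) = \<bar>h (norm y)\<bar>" by (simp add: norm_sgn)
    have "?G y /\<^sub>R sqrt (1 - (norm (?G y))\<^sup>2) = (h (norm y) / sqrt (1 - (h (norm y))\<^sup>2)) *\<^sub>R sgn y"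
      unfolding nG by (simp only: power2_abs divide_inverse scaleR_scaleR mult.commute)
    then show ?thesis unfolding grad[OF that] by (simp only: h_def minkowski_slope_inverse)
  next
    case True
    then show ?thesis unfolding grad[OF that] by simp
  qed
  show ?thesis
    unfolding neumann_solution_def
  proof (intro conjI ballI)
    show "C2_closure \<Omega> ?u"
      unfolding C2_closure_def
    proof (intro exI[of _ ?G] exI[of _ "radial_jacobian h h'"] conjI ballI)
      have "continuous_on {R1..R2} v" using v by (intro DERIV_continuous_on) auto
      then have "continuous_on {x::'a. R1 \<le> norm x \<and> norm x \<le> R2} ?u"
        by (rule continuous_on_compose2) (auto intro!: continuous_intros)
      then show "continuous_on (closure \<Omega>) ?u" by (rule continuous_on_subset[OF _ cl])
    qed (auto intro!: G radial_field_deriv[OF dom sph] continuous_on_subset[OF radial_field_cont[OF sph] cl]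
           continuous_on_subset[OF radial_jacobian_cont[OF sph] cl])
  next
    fix x assume x: "x \<in> \<Omega>"
    show "norm (gradient ?u x) < 1" using nG by (simp only: grad[OF x])
    have "((\<lambda>y. p (norm y) *\<^sub>R sgn y) has_derivative blinfun_apply (radial_jacobian p p' x)) (at x)"
      by (rule radial_field_deriv[OF dom spp x])
    then have "((\<lambda>y. gradient ?u y /\<^sub>R sqrt (1 - (norm (gradient ?u y))\<^sup>2)) has_derivative
        blinfun_apply (radial_jacobian p p' x)) (at x)"
      by (rule has_derivative_transform_within_open[OF _ radial_domain_open[OF dom] x]) (simp add: flux)
    from frechet_derivative_at[OF this]
    have "divergence (\<lambda>y. gradient ?u y /\<^sub>R sqrt (1 - (norm (gradient ?u y))\<^sup>2)) x
        = (\<Sum>b\<in>Basis. blinfun_apply (radial_jacobian p p' x) b \<bullet> b)"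
      unfolding divergence_def by simp
    also have "\<dots> = p' (norm x) + n * radial_quotient p (p' 0) (norm x)"
      unfolding n_def by (rule radial_jacobian_trace)
    also have "\<dots> = - f (v (norm x))"
      unfolding p'0 by (simp add: p'_def)
    finally show "- divergence (\<lambda>y. gradient ?u y /\<^sub>R sqrt (1 - (norm (gradient ?u y))\<^sup>2)) x = f (?u x)"
      by simp
    show "0 < ?u x"
      using v_pos[of "norm x"] cl closure_subset[of \<Omega>] x by auto
  next
    fix x assume "x \<in> frontier \<Omega>"
    from radial_domain_frontier[OF dom this]
    show "((\<lambda>t. ?u (x + t *\<^sub>R outer_normal R1 x)) has_real_derivative 0) (at_left 0)"
      by (rule normal_derivative_zero[OF R]) (use vh[of R1] vh[of R2] hR R in auto)
  qed
qed

section \<open>Angles of solutions and of eigenfunctions\<close>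

lemma flow_planar_curve:
  assumes fl: "radial_flow n R1 R2 \<Phi> G u q" and R: "0 \<le> R1" "R1 < R2"
    and \<Phi>: "continuous_on UNIV \<Phi>" and G: "continuous_on UNIV G"
    and ne: "\<And>r. r \<in> {R1..R2} \<Longrightarrow> u r \<noteq> e \<or> q r \<noteq> 0"
  shows "planar_curve R1 R2 (\<lambda>r. u r - e) (\<lambda>r. r ^ n * q r) (\<lambda>r. \<Phi> (q r)) (\<lambda>r. - (r ^ n * G (u r)))"
  unfolding planar_curve_def
proof (intro conjI ballI)
  have q: "continuous_on {R1..R2} q" "q R1 = 0" using fl by (auto simp: radial_flow_def)
  note u = radial_flow_u_cont[OF fl]
  show "continuous_on {R1..R2} (\<lambda>r. u r - e)" "continuous_on {R1..R2} (\<lambda>r. r ^ n * q r)"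
    by (intro continuous_intros u q)+
  show "continuous_on {R1..R2} (\<lambda>r. \<Phi> (q r))"
    by (rule continuous_on_compose2[OF \<Phi> q(1)]) auto
  show "continuous_on {R1..R2} (\<lambda>r. - (r ^ n * G (u r)))"
    by (intro continuous_intros continuous_on_compose2[OF G u]) auto
  show "R1 ^ n * q R1 = 0" by (simp add: q)
  fix r assume r: "r \<in> {R1..R2}"
  have "u r - e \<noteq> 0 \<or> r ^ n * q r \<noteq> 0" using ne[OF r] q R r by (cases "r = R1") auto
  then show "0 < (u r - e)\<^sup>2 + (r ^ n * q r)\<^sup>2" by (simp only: sum_power2_gt_zero_iff)
next
  fix r assume r: "r \<in> {R1<..<R2}"
  show "((\<lambda>r. u r - e) has_real_derivative \<Phi> (q r)) (at r)"
    by (auto intro!: derivative_eq_intros radial_flow_u_deriv[OF fl r])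
  show "((\<lambda>r. r ^ n * q r) has_real_derivative - (r ^ n * G (u r))) (at r)"
    using fl r by (auto simp: radial_flow_def)
qed (rule R)

definition flow_angle ::
  "nat \<Rightarrow> real \<Rightarrow> (real \<Rightarrow> real) \<Rightarrow> (real \<Rightarrow> real) \<Rightarrow> real \<Rightarrow> (real \<Rightarrow> real) \<Rightarrow> (real \<Rightarrow> real) \<Rightarrow> real \<Rightarrow> real" where
  "flow_angle n R1 \<Phi> G e u q =
     rotation_angle R1 (\<lambda>r. u r - e) (\<lambda>r. r ^ n * q r) (\<lambda>r. \<Phi> (q r)) (\<lambda>r. - (r ^ n * G (u r)))"

text \<open>By continuous dependence, a solution of the linear equation that vanishes at R1 coincides with the
zero solution. So an eigenfunction has w(R1) \<noteq> 0 and a well-defined starting direction.\<close>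

lemma eigen_flow:
  assumes ev: "radial_neumann_eigenvalue N R1 R2 \<mu>" and R: "0 \<le> R1" "R1 < R2"
  obtains w q where "radial_flow (N - 1) R1 R2 (\<lambda>x. x) (\<lambda>s. \<mu> * s) w q" "q R2 = 0" "w R1 \<noteq> 0"
proof -
  obtain w q where
      "\<forall>r\<in>{R1..R2}. (w has_real_derivative q r) (at r within {R1..R2})"
      "continuous_on {R1..R2} q"
      "\<forall>r\<in>{R1<..<R2}. ((\<lambda>s. s ^ (N - 1) * q s) has_real_derivative - (\<mu> * r ^ (N - 1) * w r)) (at r)"
      "q R1 = 0" and qR2: "q R2 = 0" and nz: "\<exists>r\<in>{R1..R2}. w r \<noteq> 0"
    using ev unfolding radial_neumann_eigenvalue_def by auto
  then have fl: "radial_flow (N - 1) R1 R2 (\<lambda>x. x) (\<lambda>s. \<mu> * s) w q"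
    unfolding radial_flow_def by (simp add: mult_ac)
  have fl0: "radial_flow (N - 1) R1 R2 (\<lambda>x. x) (\<lambda>s. \<mu> * s) (\<lambda>_. 0) (\<lambda>_. 0)"
    by (simp add: radial_flow_def)
  have "w R1 \<noteq> 0"
  proof
    assume 0: "w R1 = 0"
    have "w r = 0" if r: "r \<in> {R1..R2}" for r
    proof -
      have "(w r - 0)\<^sup>2 + (q r - 0)\<^sup>2 \<le> (w R1 - 0)\<^sup>2 * exp ((1 + \<bar>\<mu>\<bar>) * (r - R1))"
        by (rule radial_flow_dependence[OF fl fl0 R(1) _ _ _ _ r])
           (auto simp: abs_mult[symmetric] right_diff_distrib)
      then have "(w r)\<^sup>2 + (q r)\<^sup>2 \<le> 0" using 0 by simp
      then show ?thesis using sum_power2_le_zero_iff[of "w r" "q r"] by blast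
    qed
    then show False using nz by auto
  qed
  then show ?thesis using that fl qR2 by blast
qed

lemma eigen_planar_curve:
  assumes fl: "radial_flow n R1 R2 (\<lambda>x. x) (\<lambda>s. \<mu> * s) w q" and R: "0 \<le> R1" "R1 < R2" and w: "w R1 \<noteq> 0"
  shows "planar_curve R1 R2 (\<lambda>r. w r - 0) (\<lambda>r. r ^ n * q r) (\<lambda>r. q r) (\<lambda>r. - (r ^ n * (\<mu> * w r)))"
    and "\<And>r. r \<in> {R1..R2} \<Longrightarrow> w r \<noteq> 0 \<or> q r \<noteq> 0"
proof -
  show ne: "w r \<noteq> 0 \<or> q r \<noteq> 0" if r: "r \<in> {R1..R2}" for r
    using radial_flow_avoids_equilibrium[OF fl R(1), of 1 "\<bar>\<mu>\<bar>" 0 r] w r by (auto simp: abs_mult)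
  show "planar_curve R1 R2 (\<lambda>r. w r - 0) (\<lambda>r. r ^ n * q r) (\<lambda>r. q r) (\<lambda>r. - (r ^ n * (\<mu> * w r)))"
    using flow_planar_curve[OF fl R, of 0] ne by (auto intro!: continuous_intros)
qed

text \<open>For \<mu> < 0 the product w \<cdot> r^n q has derivative r^n(q^2 - \<mu> w^2) > 0, so it cannot vanish at both
ends.\<close>

lemma eigenvalue_nonneg:
  assumes ev: "radial_neumann_eigenvalue N R1 R2 \<mu>" and R: "0 \<le> R1" "R1 < R2"
  shows "0 \<le> \<mu>"
proof (rule ccontr)
  assume neg: "\<not> 0 \<le> \<mu>"
  obtain w q where fl: "radial_flow (N - 1) R1 R2 (\<lambda>x. x) (\<lambda>s. \<mu> * s) w q" and q: "q R2 = 0" and w: "w R1 \<noteq> 0"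
    by (rule eigen_flow[OF ev R])
  have pc: "planar_curve R1 R2 (\<lambda>r. w r - 0) (\<lambda>r. r ^ (N-1) * q r) (\<lambda>r. q r) (\<lambda>r. - (r ^ (N-1) * (\<mu> * w r)))"
    by (rule eigen_planar_curve(1)[OF fl R w])
  let ?F = "\<lambda>r. w r * (r ^ (N-1) * q r)"
  have "?F R1 < ?F R2"
  proof (rule DERIV_pos_imp_increasing_open[OF R(2)])
    fix r assume r: "R1 < r" "r < R2"
    have "(w has_real_derivative q r) (at r)"
        "((\<lambda>r. r ^ (N-1) * q r) has_real_derivative - (r ^ (N-1) * (\<mu> * w r))) (at r)"
      using pc r radial_flow_u_deriv[OF fl, of r] by (auto simp: planar_curve_def)
    then have "(?F has_real_derivative q r * (r ^ (N-1) * q r) + - (r ^ (N-1) * (\<mu> * w r)) * w r) (at r)"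
      by (rule DERIV_mult)
    moreover have "0 < q r * (r ^ (N-1) * q r) + - (r ^ (N-1) * (\<mu> * w r)) * w r"
    proof -
      have "0 < (q r)\<^sup>2 + (- \<mu>) * (w r)\<^sup>2"
      proof (cases "q r = 0")
        case True
        then have "w r \<noteq> 0" using eigen_planar_curve(2)[OF fl R w, of r] r by auto
        then have "0 < (- \<mu>) * (w r)\<^sup>2" using neg by (intro mult_pos_pos) auto
        then show ?thesis using True by simp
      next
        case False
        have "0 \<le> (- \<mu>) * (w r)\<^sup>2" using neg by (intro mult_nonneg_nonneg) auto
        moreover have "0 < (q r)\<^sup>2" using False by simp
        ultimately show ?thesis by linarith
      qed
      then have "0 < r ^ (N-1) * ((q r)\<^sup>2 + (- \<mu>) * (w r)\<^sup>2)"
        using r R by (intro mult_pos_pos) auto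
      then show ?thesis by (simp add: algebra_simps power2_eq_square)
    qed
    ultimately show "\<exists>y. (?F has_real_derivative y) (at r) \<and> 0 < y" by blast
  next
    show "continuous_on {R1..R2} ?F"
      using pc radial_flow_u_cont[OF fl] by (auto simp: planar_curve_def intro!: continuous_intros)
  qed
  moreover have "q R1 = 0" using fl by (simp add: radial_flow_def)
  ultimately show False using q by simp
qed

text \<open>The Neumann condition at R2 places the phase point back on the axis y = 0, so an
eigenfunction has turned by an integer number of half turns. This number takes the place of the
index of the eigenvalue.\<close>

definition eigen_half_turns :: "nat \<Rightarrow> real \<Rightarrow> real \<Rightarrow> real \<Rightarrow> nat \<Rightarrow> bool" where
  "eigen_half_turns n R1 R2 \<mu> m \<longleftrightarrow>
     (\<exists>w q. radial_flow n R1 R2 (\<lambda>x. x) (\<lambda>s. \<mu> * s) w q \<and> w R1 \<noteq> 0 \<and>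
            flow_angle n R1 (\<lambda>x. x) (\<lambda>s. \<mu> * s) 0 w q R2 = real m * pi)"

lemma eigenvalue_half_turns:
  assumes ev: "radial_neumann_eigenvalue N R1 R2 \<mu>" and R: "0 \<le> R1" "R1 < R2"
  shows "\<exists>m. eigen_half_turns (N - 1) R1 R2 \<mu> m"
proof -
  let ?n = "N - 1"
  obtain w q where fl: "radial_flow ?n R1 R2 (\<lambda>x. x) (\<lambda>s. \<mu> * s) w q" and q: "q R2 = 0" and w: "w R1 \<noteq> 0"
    by (rule eigen_flow[OF ev R])
  note pc = eigen_planar_curve(1)[OF fl R w]
  note \<mu> = eigenvalue_nonneg[OF ev R]
  let ?\<theta> = "flow_angle ?n R1 (\<lambda>x. x) (\<lambda>s. \<mu> * s) 0 w q R2"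
  obtain m where m: "0 < m" "R2 ^ ?n * q R2 = - ((w R1 - 0) * m * sin ?\<theta>)"
    using planar_curve_polar[OF pc, of R2] R unfolding flow_angle_def by auto
  then have "sin ?\<theta> = 0" using q w by simp
  then obtain i where i: "?\<theta> = of_int i * pi" using sin_zero_iff_int2 by blast
  have "0 \<le> ?\<theta>"
    unfolding flow_angle_def rotation_angle_def
  proof (rule integral_nonneg)
    show "rotation_rate (\<lambda>r. w r - 0) (\<lambda>r. r ^ ?n * q r) (\<lambda>r. q r) (\<lambda>r. - (r ^ ?n * (\<mu> * w r))) integrable_on {R1..R2}"
      by (rule integrable_continuous_real[OF rotation_rate_cont[OF pc]])
    fix r assume r: "r \<in> {R1..R2}"
    have "0 \<le> r ^ ?n * (q r)\<^sup>2 + \<mu> * r ^ ?n * (w r)\<^sup>2" using r R \<mu> by auto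
    then show "0 \<le> rotation_rate (\<lambda>r. w r - 0) (\<lambda>r. r ^ ?n * q r) (\<lambda>r. q r) (\<lambda>r. - (r ^ ?n * (\<mu> * w r))) r"
      unfolding rotation_rate_def by (intro divide_nonneg_nonneg sum_power2_ge_zero) (simp add: power2_eq_square mult_ac)
  qed
  moreover have "of_int i * pi < 0" if "i < 0" using that by (intro mult_neg_pos) auto
  ultimately have "0 \<le> i" using i by (cases "i < 0") auto
  then have "?\<theta> = real (nat i) * pi" using i by simp
  then show ?thesis using fl w unfolding eigen_half_turns_def by blast
qed

lemma flow_angle_gt_eigen_angle:
  assumes eh: "eigen_half_turns n R1 R2 \<mu> m" and R: "0 \<le> R1" "R1 < R2" and \<mu>: "0 \<le> \<mu>" "\<mu> < c"
    and pc: "planar_curve R1 R2 (\<lambda>r. u r - e) (\<lambda>r. r ^ n * q r) (\<lambda>r. \<Phi> (q r)) (\<lambda>r. - (r ^ n * G (u r)))"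
    and \<Phi>: "\<And>r. R1 < r \<Longrightarrow> r < R2 \<Longrightarrow> (q r)\<^sup>2 \<le> q r * \<Phi> (q r)"
    and G: "\<And>r. R1 < r \<Longrightarrow> r < R2 \<Longrightarrow> c * (u r - e)\<^sup>2 \<le> (u r - e) * G (u r)"
  shows "real m * pi < flow_angle n R1 \<Phi> G e u q R2"
proof -
  obtain w z where fl: "radial_flow n R1 R2 (\<lambda>x. x) (\<lambda>s. \<mu> * s) w z" and w: "w R1 \<noteq> 0"
    and ang: "flow_angle n R1 (\<lambda>x. x) (\<lambda>s. \<mu> * s) 0 w z R2 = real m * pi"
    using eh unfolding eigen_half_turns_def by blast
  have "flow_angle n R1 (\<lambda>x. x) (\<lambda>s. \<mu> * s) 0 w z R2 < flow_angle n R1 \<Phi> G e u q R2"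
    unfolding flow_angle_def
  proof (rule sturm_angle_comparison[OF pc eigen_planar_curve(1)[OF fl R w], of "\<lambda>r. r ^ n" \<mu> c])
    fix r assume r: "R1 < r" "r < R2"
    have rp: "0 < r ^ n" using r R by simp
    show "z r = r ^ n * z r / r ^ n" using r R by simp
    have "(r ^ n * q r)\<^sup>2 / r ^ n = r ^ n * (q r)\<^sup>2" using rp by (simp add: power2_eq_square)
    also have "\<dots> \<le> r ^ n * (q r * \<Phi> (q r))" using rp by (intro mult_left_mono \<Phi>[OF r]) auto
    finally show "(r ^ n * q r)\<^sup>2 / r ^ n \<le> r ^ n * q r * \<Phi> (q r)" by (simp add: mult_ac)
    have "r ^ n * (c * (u r - e)\<^sup>2) \<le> r ^ n * ((u r - e) * G (u r))"
      using rp by (intro mult_left_mono G[OF r]) auto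
    then show "c * r ^ n * (u r - e)\<^sup>2 \<le> - ((u r - e) * - (r ^ n * G (u r)))" by (simp add: mult_ac)
  qed (use R \<mu> in \<open>auto intro: power_mono simp: mult_ac\<close>)
  then show ?thesis using ang by simp
qed

text \<open>By the comparison of angles, the number of half turns is strictly increasing in the eigenvalue. The k
eigenvalues below the given one therefore have distinct numbers of half turns, all smaller than its own.\<close>

lemma kth_eigenvalue_half_turns:
  assumes kth: "is_kth_radial_neumann_eigenvalue N R1 R2 (k + 1) lam" and R: "0 \<le> R1" "R1 < R2"
  obtains m where "eigen_half_turns (N - 1) R1 R2 lam m" "k \<le> m"
proof -
  let ?E = "{\<mu>. radial_neumann_eigenvalue N R1 R2 \<mu> \<and> \<mu> < lam}"
  let ?P = "eigen_half_turns (N - 1) R1 R2"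
  have ev: "radial_neumann_eigenvalue N R1 R2 lam" and fin: "finite ?E" and card: "card ?E = k"
    using kth by (auto simp: is_kth_radial_neumann_eigenvalue_def)
  define M where "M \<mu> = (SOME m. ?P \<mu> m)" for \<mu>
  have M: "?P \<mu> (M \<mu>)" if "radial_neumann_eigenvalue N R1 R2 \<mu>" for \<mu>
    unfolding M_def by (rule someI_ex[OF eigenvalue_half_turns[OF that R]])
  have mono: "M \<mu> < M \<nu>" if e: "radial_neumann_eigenvalue N R1 R2 \<mu>" "radial_neumann_eigenvalue N R1 R2 \<nu>" and lt: "\<mu> < \<nu>" for \<mu> \<nu>
  proof -
    obtain w q where fl: "radial_flow (N - 1) R1 R2 (\<lambda>x. x) (\<lambda>s. \<nu> * s) w q" and w: "w R1 \<noteq> 0"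
      and ang: "flow_angle (N - 1) R1 (\<lambda>x. x) (\<lambda>s. \<nu> * s) 0 w q R2 = real (M \<nu>) * pi"
      using M[OF e(2)] unfolding eigen_half_turns_def by blast
    have "real (M \<mu>) * pi < flow_angle (N - 1) R1 (\<lambda>x. x) (\<lambda>s. \<nu> * s) 0 w q R2"
      by (rule flow_angle_gt_eigen_angle[OF M[OF e(1)] R eigenvalue_nonneg[OF e(1) R] lt eigen_planar_curve(1)[OF fl R w]])
         (auto simp: power2_eq_square)
    then show ?thesis unfolding ang by simp
  qed
  have "inj_on M ?E"
    by (rule linorder_inj_onI) (use mono in \<open>force+\<close>)
  then have "card ?E = card (M ` ?E)" by (simp add: card_image)
  also have "\<dots> \<le> card {..<M lam}"
    by (rule card_mono) (use mono ev in auto)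
  finally have "k \<le> M lam" using card by simp
  then show ?thesis using that M[OF ev] by blast
qed

lemma continuous_on_of_lipschitz_family:
  fixes F :: "real \<Rightarrow> real \<Rightarrow> real"
  assumes lip: "\<And>d d' r. r \<in> I \<Longrightarrow> \<bar>F d r - F d' r\<bar> \<le> C * \<bar>d - d'\<bar>"
    and cont: "\<And>d. continuous_on I (F d)"
  shows "continuous_on (S \<times> I) (\<lambda>x. F (fst x) (snd x))"
  unfolding continuous_on_def
proof
  fix x0 assume x0: "x0 \<in> S \<times> I"
  obtain d0 r0 where x0_eq: "x0 = (d0, r0)" by (cases x0)
  let ?B = "\<lambda>x. C * \<bar>fst x - d0\<bar> + \<bar>F d0 (snd x) - F d0 r0\<bar>"
  have "continuous_on (S \<times> I) ?B"
    by (intro continuous_intros continuous_on_compose2[OF cont]) auto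
  then have "(?B \<longlongrightarrow> ?B x0) (at x0 within S \<times> I)" using x0 by (auto simp: continuous_on_def)
  then have lim: "(?B \<longlongrightarrow> 0) (at x0 within S \<times> I)" by (simp add: x0_eq)
  have "((\<lambda>x. F (fst x) (snd x) - F (fst x0) (snd x0)) \<longlongrightarrow> 0) (at x0 within S \<times> I)"
  proof (rule Lim_null_comparison[OF _ lim])
    have "norm (F (fst x) (snd x) - F (fst x0) (snd x0)) \<le> ?B x" if "x \<in> S \<times> I" for x
      using lip[of "snd x" "fst x" d0] that by (auto simp: x0_eq)
    then show "\<forall>\<^sub>F x in at x0 within S \<times> I. norm (F (fst x) (snd x) - F (fst x0) (snd x0)) \<le> ?B x"
      by (auto simp: eventually_at_filter)
  qed
  then show "((\<lambda>x. F (fst x) (snd x)) \<longlongrightarrow> F (fst x0) (snd x0)) (at x0 within S \<times> I)"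
    by (rule LIM_zero_cancel)
qed

text \<open>Since the solutions depend on d in a Lipschitz way, uniformly in r, the integrand of the angle is
jointly continuous in (d,r).\<close>

lemma flow_angle_continuous:
  assumes fl: "\<And>d. radial_flow n R1 R2 \<Phi> G (U d) (Q d)" and R: "0 \<le> R1" "R1 < R2"
    and lipU: "\<And>d d' r. r \<in> {R1..R2} \<Longrightarrow> \<bar>U d r - U d' r\<bar> \<le> C * \<bar>d - d'\<bar>"
    and lipQ: "\<And>d d' r. r \<in> {R1..R2} \<Longrightarrow> \<bar>Q d r - Q d' r\<bar> \<le> C * \<bar>d - d'\<bar>"
    and \<Phi>: "continuous_on UNIV \<Phi>" and G: "continuous_on UNIV G"
    and ne: "\<And>d r. d \<in> S \<Longrightarrow> r \<in> {R1..R2} \<Longrightarrow> U d r \<noteq> e \<or> Q d r \<noteq> 0"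
  shows "continuous_on S (\<lambda>d. flow_angle n R1 \<Phi> G e (U d) (Q d) R2)"
proof -
  let ?I = "{R1..R2}"
  have cU: "continuous_on (S \<times> ?I) (\<lambda>x. U (fst x) (snd x))"
    by (rule continuous_on_of_lipschitz_family[OF lipU radial_flow_u_cont[OF fl]])
  have cQ: "continuous_on (S \<times> ?I) (\<lambda>x. Q (fst x) (snd x))"
    by (rule continuous_on_of_lipschitz_family[OF lipQ]) (use fl in \<open>auto simp: radial_flow_def\<close>)
  have nz: "(U d r - e)\<^sup>2 + (r ^ n * Q d r)\<^sup>2 \<noteq> 0" if "d \<in> S" "r \<in> ?I" for d r
    using flow_planar_curve[OF fl R \<Phi> G ne[OF that(1)]] that(2)
    unfolding planar_curve_def by fastforce
  have "continuous_on (S \<times> cbox R1 R2) (\<lambda>(d, r). rotation_rate (\<lambda>r. U d r - e) (\<lambda>r. r ^ n * Q d r)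
          (\<lambda>r. \<Phi> (Q d r)) (\<lambda>r. - (r ^ n * G (U d r))) r)"
    unfolding rotation_rate_def case_prod_beta cbox_interval
    by (intro continuous_intros cU cQ continuous_on_compose2[OF \<Phi> cQ] continuous_on_compose2[OF G cU])
       (use nz in auto)
  then have "continuous_on S (\<lambda>d. integral (cbox R1 R2) (\<lambda>r. rotation_rate (\<lambda>r. U d r - e) (\<lambda>r. r ^ n * Q d r)
          (\<lambda>r. \<Phi> (Q d r)) (\<lambda>r. - (r ^ n * G (U d r))) r))"
    by (rule integral_continuous_on_param)
  then show ?thesis by (simp add: flow_angle_def rotation_angle_def)
qed

text \<open>A curve that leaves the half plane of its starting point has to pass through the angle \<pi>/2, where
u = e.\<close>

lemma flow_angle_small:
  assumes pc: "planar_curve R1 R2 (\<lambda>r. u r - e) (\<lambda>r. r ^ n * q r) (\<lambda>r. \<Phi> (q r)) (\<lambda>r. - (r ^ n * G (u r)))"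
    and ne: "\<And>r. r \<in> {R1..R2} \<Longrightarrow> u r \<noteq> e"
  shows "flow_angle n R1 \<Phi> G e u q R2 < pi / 2"
proof (rule ccontr)
  let ?\<theta> = "flow_angle n R1 \<Phi> G e u q"
  assume "\<not> ?\<theta> R2 < pi / 2"
  moreover have "?\<theta> R1 \<le> pi / 2" by (simp add: flow_angle_def)
  moreover have "continuous_on {R1..R2} ?\<theta>" unfolding flow_angle_def by (rule rotation_angle_cont[OF pc])
  ultimately obtain r where r: "R1 \<le> r" "r \<le> R2" "?\<theta> r = pi / 2"
    using IVT'[of ?\<theta> R1 "pi/2" R2] pc by (auto simp: planar_curve_def)
  then have rI: "r \<in> {R1..R2}" by simp
  obtain m where "u r - e = (u R1 - e) * m * cos (?\<theta> r)"
    by (rule planar_curve_polar[OF pc rI, folded flow_angle_def])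
  then show False unfolding r(3) using ne[OF rI] by simp
qed

text \<open>If u vanishes for the first time at t, then q(t) < 0, because (0,0) is an equilibrium. From then on
u decreases below 0, where G vanishes, so the flux r^n q stays constant and negative up to R2.
This contradicts the Neumann condition.\<close>

lemma flow_positive:
  assumes fl: "radial_flow n R1 R2 \<Phi> G u q" and R: "0 \<le> R1" "R1 < R2"
    and sgn: "\<And>x. x \<noteq> 0 \<Longrightarrow> 0 < x * \<Phi> x" and G0: "\<And>s. s \<le> 0 \<Longrightarrow> G s = 0"
    and ne: "\<And>r. r \<in> {R1..R2} \<Longrightarrow> u r \<noteq> 0 \<or> q r \<noteq> 0"
    and u1: "0 < u R1" and q2: "q R2 = 0" and r: "r \<in> {R1..R2}"
  shows "0 < u r"
proof (rule ccontr)
  assume "\<not> 0 < u r"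
  then have "u r \<le> 0" by simp
  note uc = radial_flow_u_cont[OF fl]
  have qc: "continuous_on {R1..R2} q" using fl by (simp add: radial_flow_def)
  obtain t where t: "R1 < t" "t \<le> r" "u t = 0" "\<And>s. R1 \<le> s \<Longrightarrow> s < t \<Longrightarrow> 0 < u s"
    by (rule first_zero[of R1 r u]) (use r u1 \<open>u r \<le> 0\<close> continuous_on_subset[OF uc, of "{R1..r}"] in auto)
  have tI: "t \<in> {R1..R2}" using t r by auto
  have qt: "q t < 0"
  proof (rule ccontr)
    assume "\<not> q t < 0"
    then have "0 < q t" using ne[OF tI] t(3) by auto
    then have "0 < \<Phi> (q t)" using sgn[of "q t"] by (simp add: zero_less_mult_iff)
    moreover have "(u has_real_derivative \<Phi> (q t)) (at t within {R1..R2})"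
      using fl tI by (simp add: radial_flow_def)
    ultimately obtain \<delta> where \<delta>: "\<delta> > 0" "\<And>h. h > 0 \<Longrightarrow> t - h \<in> {R1..R2} \<Longrightarrow> h < \<delta> \<Longrightarrow> u (t - h) < u t"
      using has_real_derivative_pos_inc_left[of u _ t "{R1..R2}"] by blast
    define h where "h = min (\<delta> / 2) (t - R1)"
    have "h > 0" "t - h \<in> {R1..R2}" "h < \<delta>" using \<delta>(1) t tI by (auto simp: h_def min_def)
    then have "u (t - h) < 0" using \<delta>(2) t(3) by auto
    moreover have "0 < u (t - h)" using t(4)[of "t - h"] \<open>h > 0\<close> \<open>t - h \<in> {R1..R2}\<close> by auto
    ultimately show False by simp
  qed
  \<comment> \<open>The first zero of q after t; it exists since q vanishes at R2.\<close>
  obtain s where s: "t < s" "s \<le> R2" "- q s = 0" "\<And>x. t \<le> x \<Longrightarrow> x < s \<Longrightarrow> 0 < - q x"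
    by (rule first_zero[of t R2 "\<lambda>x. - q x"])
       (use tI qt q2 continuous_on_subset[OF qc, of "{t..R2}"] in \<open>auto intro!: continuous_intros\<close>)
  have neg: "u x \<le> 0" if x: "t \<le> x" "x \<le> s" for x
  proof -
    have "u x \<le> u t"
    proof (rule DERIV_nonpos_imp_decreasing_open[of t x u])
      fix y assume y: "t < y" "y < x"
      then have "y \<in> {R1<..<R2}" using t s x by auto
      moreover have "\<Phi> (q y) \<le> 0" using s(4)[of y] sgn[of "q y"] y x by (simp add: zero_less_mult_iff)
      ultimately show "\<exists>D. (u has_real_derivative D) (at y) \<and> D \<le> 0"
        using radial_flow_u_deriv[OF fl] by blast
    next
      show "continuous_on {t..x} u" using t s x by (intro continuous_on_subset[OF uc]) auto
    qed (use x in auto)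
    then show ?thesis using t by simp
  qed
  have "s ^ n * q s \<le> t ^ n * q t"
  proof (rule DERIV_nonpos_imp_decreasing_open[of t s "\<lambda>x. x ^ n * q x"])
    fix y assume y: "t < y" "y < s"
    then have "((\<lambda>x. x ^ n * q x) has_real_derivative - (y ^ n * G (u y))) (at y)"
      using fl t s by (auto simp: radial_flow_def)
    then show "\<exists>D. ((\<lambda>x. x ^ n * q x) has_real_derivative D) (at y) \<and> D \<le> 0"
      using neg[of y] y G0 by (intro exI[of _ 0]) auto
  next
    have "continuous_on {t..s} q" using t s tI by (intro continuous_on_subset[OF qc]) auto
    then show "continuous_on {t..s} (\<lambda>x. x ^ n * q x)" by (intro continuous_intros)
  qed (use s in auto)
  moreover have "t ^ n * q t < 0" using t R qt by (intro mult_pos_neg) auto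
  ultimately show False using s(3) by simp
qed

text \<open>The sign conditions make the angle strictly increasing, and u - e vanishes exactly where the cosine
of the angle does.\<close>

lemma card_flow_zeros:
  assumes R: "0 \<le> R1" "R1 < R2"
    and pc: "planar_curve R1 R2 (\<lambda>r. u r - e) (\<lambda>r. r ^ n * q r) (\<lambda>r. \<Phi> (q r)) (\<lambda>r. - (r ^ n * G (u r)))"
    and sgn: "\<And>x. x \<noteq> 0 \<Longrightarrow> 0 < x * \<Phi> x"
    and G: "\<And>r. r \<in> {R1..R2} \<Longrightarrow> u r \<noteq> e \<Longrightarrow> 0 < (u r - e) * G (u r)"
    and ang: "flow_angle n R1 \<Phi> G e u q R2 = real j * pi"
  shows "card {r\<in>{R1<..<R2}. u r - e = 0} = j"
proof -
  let ?\<theta> = "flow_angle n R1 \<Phi> G e u q"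
  have cont: "continuous_on {R1..R2} ?\<theta>" unfolding flow_angle_def by (rule rotation_angle_cont[OF pc])
  have rate: "0 < rotation_rate (\<lambda>r. u r - e) (\<lambda>r. r ^ n * q r) (\<lambda>r. \<Phi> (q r)) (\<lambda>r. - (r ^ n * G (u r))) r"
    if r: "r \<in> {R1<..<R2}" for r
  proof -
    have rp: "0 < r ^ n" using r R by simp
    have den: "0 < (u r - e)\<^sup>2 + (r ^ n * q r)\<^sup>2" using pc r by (auto simp: planar_curve_def)
    have a: "0 \<le> q r * \<Phi> (q r)" using sgn[of "q r"] by (cases "q r = 0") auto
    have b: "0 \<le> (u r - e) * G (u r)" using G[of r] r by (cases "u r = e") auto
    have "0 < q r * \<Phi> (q r) + (u r - e) * G (u r)"
    proof (cases "q r = 0")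
      case True
      then have "u r \<noteq> e" using den by auto
      then show ?thesis using G[of r] r a by simp
    next
      case False
      then show ?thesis using sgn[of "q r"] b by simp
    qed
    then have "0 < r ^ n * (q r * \<Phi> (q r) + (u r - e) * G (u r))" using rp by simp
    then show ?thesis unfolding rotation_rate_def using den
      by (intro divide_pos_pos) (auto simp: algebra_simps)
  qed
  have mono: "?\<theta> s < ?\<theta> t" if st: "R1 \<le> s" "s < t" "t \<le> R2" for s t
  proof (rule DERIV_pos_imp_increasing_open[OF st(2)])
    fix x assume "s < x" "x < t"
    then have x: "x \<in> {R1<..<R2}" using st by auto
    show "\<exists>y. (?\<theta> has_real_derivative y) (at x) \<and> 0 < y"
      unfolding flow_angle_def using rotation_angle_deriv[OF pc x] rate[OF x] by blast
  qed (use st in \<open>auto intro: continuous_on_subset[OF cont]\<close>)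
  have "{r\<in>{R1<..<R2}. u r - e = 0} = {r\<in>{R1<..<R2}. cos (?\<theta> r) = 0}"
  proof -
    have "u r - e = 0 \<longleftrightarrow> cos (?\<theta> r) = 0" if r: "r \<in> {R1<..<R2}" for r
    proof -
      obtain m where "0 < m" "u r - e = (u R1 - e) * m * cos (?\<theta> r)"
        using planar_curve_polar[OF pc, of r] r unfolding flow_angle_def by auto
      then show ?thesis using planar_curve_start[OF pc] by simp
    qed
    then show ?thesis by blast
  qed
  then show ?thesis
    using card_cos_zeros[OF R(2) cont mono _ ang] by (simp add: flow_angle_def)
qed

section \<open>Shooting\<close>

lemma minkowski_slope_lipschitz: "\<bar>minkowski_slope a - minkowski_slope b\<bar> \<le> \<bar>a - b\<bar>"
proof -
  have "norm (minkowski_slope a - minkowski_slope b) \<le> 1 * norm (a - b)"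
  proof (rule field_differentiable_bound[of UNIV])
    fix p :: real
    show "(minkowski_slope has_field_derivative 1 / ((1 + p\<^sup>2) * sqrt (1 + p\<^sup>2))) (at p within UNIV)"
      by (rule minkowski_slope_deriv)
    have "1 * 1 \<le> (1 + p\<^sup>2) * sqrt (1 + p\<^sup>2)" by (rule mult_mono) auto
    then show "norm (1 / ((1 + p\<^sup>2) * sqrt (1 + p\<^sup>2))) \<le> 1"
      by (simp add: abs_mult divide_le_eq)
  qed auto
  then show ?thesis by simp
qed

text \<open>l'Hospital's rule for q/r = (r^n q)/r^(n+1): the quotient of the derivatives is -G(u)/(n+1).\<close>

lemma radial_flow_deriv_origin:
  assumes fl: "radial_flow n 0 R \<Phi> G u q" and R: "0 < R" and G: "continuous_on {0..R} (\<lambda>r. G (u r))"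
  shows "(q has_real_derivative - G (u 0) / real (n + 1)) (at 0 within {0..R})"
proof -
  have qc: "continuous_on {0..R} q" and q0: "q 0 = 0" using fl by (auto simp: radial_flow_def)
  have nhds: "\<forall>\<^sub>F r in at_right 0. r \<in> {0<..<R}"
    by (rule eventually_at_right_real[OF R])
  have at0: "at 0 within {0..R} = at_right (0::real)" using R by (simp add: at_within_Icc_at_right)
  have "((\<lambda>r. (r ^ n * q r) / r ^ (n + 1)) \<longlongrightarrow> - G (u 0) / real (n + 1)) (at_right 0)"
  proof (rule lhopital_right_0[where f' = "\<lambda>r. - (r ^ n * G (u r))" and g' = "\<lambda>r. real (n + 1) * r ^ n"])
    have "(q \<longlongrightarrow> 0) (at_right 0)"
      using qc R q0 unfolding at0[symmetric] by (force simp: continuous_on_def)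
    moreover have "((\<lambda>r. r ^ n) \<longlongrightarrow> 0 ^ n) (at_right (0::real))" by (intro tendsto_intros)
    ultimately show "((\<lambda>r. r ^ n * q r) \<longlongrightarrow> 0) (at_right 0)"
      using tendsto_mult by fastforce
    show "((\<lambda>r::real. r ^ (n + 1)) \<longlongrightarrow> 0) (at_right 0)"
    proof -
      have "((\<lambda>r::real. r ^ (n + 1)) \<longlongrightarrow> 0 ^ (n + 1)) (at_right 0)" by (intro tendsto_intros)
      then show ?thesis by simp
    qed
    show "\<forall>\<^sub>F r::real in at_right 0. r ^ (n + 1) \<noteq> 0"
      using nhds by eventually_elim auto
    show "\<forall>\<^sub>F r::real in at_right 0. real (n + 1) * r ^ n \<noteq> 0"
      using nhds by eventually_elim auto
    show "\<forall>\<^sub>F r in at_right 0. ((\<lambda>r. r ^ n * q r) has_real_derivative - (r ^ n * G (u r))) (at r)"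
      using nhds by eventually_elim (use fl in \<open>auto simp: radial_flow_def\<close>)
    show "\<forall>\<^sub>F r::real in at_right 0. ((\<lambda>r. r ^ (n + 1)) has_real_derivative real (n + 1) * r ^ n) (at r)"
      using DERIV_pow[of "n + 1"] by simp
    have "((\<lambda>r. G (u r)) \<longlongrightarrow> G (u 0)) (at_right 0)"
      using G R unfolding at0[symmetric] by (auto simp: continuous_on_def)
    then have "((\<lambda>r. - G (u r) / real (n + 1)) \<longlongrightarrow> - G (u 0) / real (n + 1)) (at_right 0)"
      by (intro tendsto_intros) auto
    then show "((\<lambda>r. - (r ^ n * G (u r)) / (real (n + 1) * r ^ n)) \<longlongrightarrow> - G (u 0) / real (n + 1)) (at_right 0)"
    proof (rule Lim_transform_eventually)
      have "- G (u r) / real (n + 1) = - (r ^ n * G (u r)) / (real (n + 1) * r ^ n)" if "r \<in> {0<..<R}" for r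
      proof -
        have "- (r ^ n * G (u r)) = (- G (u r)) * r ^ n" by simp
        moreover have nz: "r ^ n \<noteq> 0" using that by simp
        ultimately show ?thesis by (simp only: nonzero_mult_divide_mult_cancel_right[OF nz])
      qed
      then show "\<forall>\<^sub>F r in at_right 0. - G (u r) / real (n + 1) = - (r ^ n * G (u r)) / (real (n + 1) * r ^ n)"
        using nhds by (rule eventually_mono[rotated])
    qed
  qed
  then have "((\<lambda>r. (q r - q 0) / (r - 0)) \<longlongrightarrow> - G (u 0) / real (n + 1)) (at_right 0)"
  proof (rule Lim_transform_eventually)
    show "\<forall>\<^sub>F r in at_right 0. (r ^ n * q r) / r ^ (n + 1) = (q r - q 0) / (r - 0)"
      using nhds by eventually_elim (auto simp: q0 field_simps)
  qed
  then show ?thesis unfolding at0 has_field_derivative_iff .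
qed

definition radial_solution ::
  "nat \<Rightarrow> real \<Rightarrow> real \<Rightarrow> (real \<Rightarrow> real) \<Rightarrow> (real \<Rightarrow> real) \<Rightarrow> (real \<Rightarrow> real) \<Rightarrow> bool" where
  "radial_solution n R1 R2 f v p \<longleftrightarrow>
     radial_flow n R1 R2 minkowski_slope f v p \<and> p R2 = 0 \<and> (\<forall>r\<in>{R1..R2}. 0 < v r)"

text \<open>Multiplying the flux by a constant a changes (\<phi>, f) into (\<phi>(\<cdot>/a), a f) and distorts the
phase plane along its second axis, but keeps both axes, hence the Neumann condition and the zeros.\<close>

lemma radial_flow_rescale:
  assumes fl: "radial_flow n R1 R2 (\<lambda>x. \<phi> (x / a)) (\<lambda>s. a * g s) u q" and a: "a \<noteq> 0"
    and eq: "\<And>r. r \<in> {R1..R2} \<Longrightarrow> g (u r) = f (u r)"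
  shows "radial_flow n R1 R2 \<phi> f u (\<lambda>r. q r / a)"
  unfolding radial_flow_def
proof (intro conjI ballI)
  fix r assume r: "r \<in> {R1<..<R2}"
  have "((\<lambda>s. s ^ n * q s) has_real_derivative - (r ^ n * (a * g (u r)))) (at r)"
    using fl r by (simp add: radial_flow_def)
  then have "((\<lambda>s. s ^ n * q s / a) has_real_derivative - (r ^ n * (a * g (u r))) / a) (at r)"
    by (rule DERIV_cdivide)
  then show "((\<lambda>s. s ^ n * (q s / a)) has_real_derivative - (r ^ n * f (u r))) (at r)"
    using a eq[of r] r by simp
qed (use fl a in \<open>auto simp: radial_flow_def intro!: continuous_intros\<close>)

lemma radial_flow_speed_bound:
  assumes fl: "radial_flow n R1 R2 \<Phi> G u q" and \<Phi>: "\<And>x. \<bar>\<Phi> x\<bar> \<le> 1" and r: "r \<in> {R1..R2}"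
  shows "\<bar>u r - u R1\<bar> \<le> R2 - R1"
proof -
  have "norm (u r - u R1) \<le> 1 * norm (r - R1)"
    by (rule field_differentiable_bound[of "{R1..R2}" u "\<lambda>r. \<Phi> (q r)"])
       (use fl \<Phi> r in \<open>auto simp: radial_flow_def\<close>)
  then show ?thesis using r by simp
qed

text \<open>Shooting in d = u(R1). The total angle \<Theta>(d) depends continuously on d \<noteq> s0. It is below
\<pi>/2 if u does not reach s0, which happens for d close to 0 by continuous dependence and for
d > s0 + R2 - R1 because |u'| < 1. It exceeds m\<pi> for d close to s0 by comparison with
the eigenfunction, which makes m half turns. So on either side of s0 there is a d with \<Theta>(d) = j\<pi>, and this is the
Neumann condition together with the number of zeros.

Near the equilibrium \<Phi>(q)/q is slightly less than 1 for the original equation, whereas the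
comparison asks for \<Phi>(q) q \<ge> q^2. Rescaling the flux by a constant a < 1 with a f'(s0) > \<lambda>
turns the limit of the ratio at q = 0 into 1/a > 1, at the expense of a part of the gap between f'(s0) and
\<lambda>.\<close>

lemma radial_solutions_exist:
  fixes f f' :: "real \<Rightarrow> real"
  assumes R: "0 \<le> R1" "R1 < R2" and s0: "0 < s0"
    and f_deriv: "\<And>s. s \<ge> 0 \<Longrightarrow> (f has_real_derivative f' s) (at s within {0..})"
    and f'_cont: "continuous_on {0..} f'"
    and f_zeros: "f 0 = 0" "f s0 = 0"
    and f_neg: "\<And>s. 0 < s \<Longrightarrow> s < s0 \<Longrightarrow> f s < 0"
    and f_pos: "\<And>s. s > s0 \<Longrightarrow> f s > 0"
    and eh: "eigen_half_turns n R1 R2 lam m" and lam: "0 \<le> lam" "lam < f' s0"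
    and j: "1 \<le> j" "j \<le> m"
  shows "\<exists>v p. radial_solution n R1 R2 f v p \<and> v R1 < s0 \<and> card {r\<in>{R1<..<R2}. v r - s0 = 0} = j"
    and "\<exists>v p. radial_solution n R1 R2 f v p \<and> s0 < v R1 \<and> card {r\<in>{R1<..<R2}. v r - s0 = 0} = j"
proof -
  \<comment> \<open>No u starting at d \<in> [0, dM] exceeds M, so f may be extended by constants outside [0, M], which makes it globally Lipschitz.\<close>
  define dM where "dM = s0 + (R2 - R1) + 1"
  define M where "M = dM + (R2 - R1)"
  have M: "s0 < dM" "dM < M" using R by (auto simp: dM_def M_def)
  define fc where "fc s = f (max 0 (min M s))" for s
  have fc_eq: "fc s = f s" if "0 \<le> s" "s \<le> M" for s using that by (simp add: fc_def)
  have fc_neg: "fc s = 0" if "s \<le> 0" for s using that M s0 f_zeros by (simp add: fc_def)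
  have "continuous_on {0..M} f'" by (rule continuous_on_subset[OF f'_cont]) auto
  from compact_imp_bounded[OF compact_continuous_image[OF this compact_Icc]]
  obtain B where B: "\<And>s. s \<in> {0..M} \<Longrightarrow> \<bar>f' s\<bar> \<le> B" unfolding bounded_iff by fastforce
  have B0: "0 \<le> B" using B[of 0] M s0 by auto
  have fc_lip: "\<bar>fc a - fc b\<bar> \<le> B * \<bar>a - b\<bar>" for a b
  proof -
    let ?c = "\<lambda>s. max 0 (min M s)"
    have "norm (f (?c a) - f (?c b)) \<le> B * norm (?c a - ?c b)"
    proof (rule field_differentiable_bound[of "{0..M}" f f'])
      fix s assume s: "s \<in> {0..M}"
      show "(f has_field_derivative f' s) (at s within {0..M})"
        by (rule DERIV_subset[OF f_deriv]) (use s in auto)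
    qed (use M s0 B in auto)
    also have "\<dots> \<le> B * \<bar>a - b\<bar>" using B0 by (intro mult_left_mono) auto
    finally show ?thesis by (simp add: fc_def)
  qed

  \<comment> \<open>Two intermediate values: lam < a * c1 < c1 < f' s0.\<close>
  define c1 where "c1 = (lam + f' s0) / 2"
  have c1: "lam < c1" "c1 < f' s0" "0 < c1" using lam by (auto simp: c1_def)
  define a where "a = (1 + lam / c1) / 2"
  have a: "0 < a" "a < 1" "lam < a * c1" using c1 lam by (auto simp: a_def field_simps)
  define \<Phi> where "\<Phi> x = minkowski_slope (x / a)" for x
  define G where "G s = a * fc s" for s
  define K where "K = 1 / a"
  define L where "L = a * B"
  have KL: "0 \<le> K" "0 \<le> L" using a B0 by (auto simp: K_def L_def)
  have K: "\<bar>\<Phi> x - \<Phi> y\<bar> \<le> K * \<bar>x - y\<bar>" for x y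
    using minkowski_slope_lipschitz[of "x / a" "y / a"] a
    by (simp add: \<Phi>_def K_def diff_divide_distrib[symmetric] abs_divide)
  have L: "\<bar>G x - G y\<bar> \<le> L * \<bar>x - y\<bar>" for x y
    using mult_left_mono[OF fc_lip[of x y], of a] a
    by (simp add: G_def L_def right_diff_distrib[symmetric] abs_mult mult.assoc)
  have \<Phi>0: "\<Phi> 0 = 0" by (simp add: \<Phi>_def)
  have \<Phi>c: "continuous_on UNIV \<Phi>" and Gc: "continuous_on UNIV G"
    using lipschitz_imp_continuous[OF K KL(1)] lipschitz_imp_continuous[OF L KL(2)] by auto
  have \<Phi>sgn: "0 < x * \<Phi> x" if "x \<noteq> 0" for x
  proof -
    have "0 < x\<^sup>2 / (a * sqrt (1 + (x / a)\<^sup>2))"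
      using that a by (intro divide_pos_pos mult_pos_pos) (auto simp: add_pos_nonneg)
    also have "\<dots> = x * \<Phi> x" by (simp add: \<Phi>_def minkowski_slope_def power2_eq_square)
    finally show ?thesis .
  qed
  have G0: "G 0 = 0" "G s0 = 0" using f_zeros M s0 by (auto simp: G_def fc_eq)

  have "\<forall>d. \<exists>uq. radial_flow n R1 R2 \<Phi> G (fst uq) (snd uq) \<and> fst uq R1 = d"
  proof
    fix d
    obtain u q where "radial_flow n R1 R2 \<Phi> G u q" "u R1 = d"
      by (rule radial_flow_exists[OF R(1) less_imp_le[OF R(2)] K L KL])
    then show "\<exists>uq. radial_flow n R1 R2 \<Phi> G (fst uq) (snd uq) \<and> fst uq R1 = d"
      by (intro exI[of _ "(u, q)"]) simp
  qed
  then obtain W where W: "\<And>d. radial_flow n R1 R2 \<Phi> G (fst (W d)) (snd (W d)) \<and> fst (W d) R1 = d"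
    by metis
  define U where "U d = fst (W d)" for d
  define Q where "Q d = snd (W d)" for d
  have fl: "radial_flow n R1 R2 \<Phi> G (U d) (Q d)" and Ud: "U d R1 = d" for d
    using W[of d] by (auto simp: U_def Q_def)
  define C where "C = exp ((K + L) * (R2 - R1))"
  have C: "1 \<le> C" using KL R by (auto simp: C_def)
  have dep: "\<bar>u1 r - u2 r\<bar> \<le> C * \<bar>u1 R1 - u2 R1\<bar> \<and> \<bar>q1 r - q2 r\<bar> \<le> C * \<bar>u1 R1 - u2 R1\<bar>"
    if "radial_flow n R1 R2 \<Phi> G u1 q1" "radial_flow n R1 R2 \<Phi> G u2 q2" and r: "r \<in> {R1..R2}" for u1 q1 u2 q2 r
  proof -
    have "(u1 r - u2 r)\<^sup>2 + (q1 r - q2 r)\<^sup>2 \<le> (u1 R1 - u2 R1)\<^sup>2 * exp ((K + L) * (r - R1))"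
      by (rule radial_flow_dependence[OF that(1,2) R(1) K L KL r])
    also have "\<dots> \<le> (u1 R1 - u2 R1)\<^sup>2 * C"
      unfolding C_def using r KL by (intro mult_left_mono) (auto intro!: mult_left_mono)
    also have "\<dots> \<le> (u1 R1 - u2 R1)\<^sup>2 * C\<^sup>2"
      using C by (intro mult_left_mono) (auto simp: power2_eq_square)
    finally have *: "(u1 r - u2 r)\<^sup>2 + (q1 r - q2 r)\<^sup>2 \<le> (C * \<bar>u1 R1 - u2 R1\<bar>)\<^sup>2"
      by (simp add: power_mult_distrib mult.commute)
    have "\<bar>u1 r - u2 r\<bar>\<^sup>2 \<le> (C * \<bar>u1 R1 - u2 R1\<bar>)\<^sup>2" "\<bar>q1 r - q2 r\<bar>\<^sup>2 \<le> (C * \<bar>u1 R1 - u2 R1\<bar>)\<^sup>2"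
      using * zero_le_power2[of "u1 r - u2 r"] zero_le_power2[of "q1 r - q2 r"] by (simp_all only: power2_abs)
    then show ?thesis using C by (auto intro: power2_le_imp_le)
  qed
  have lip: "\<bar>U d r - U d' r\<bar> \<le> C * \<bar>d - d'\<bar>" "\<bar>Q d r - Q d' r\<bar> \<le> C * \<bar>d - d'\<bar>"
    if "r \<in> {R1..R2}" for d d' r
    using dep[OF fl[of d] fl[of d'] that] by (auto simp: Ud)
  have near_eq: "\<bar>U d r - e\<bar> \<le> C * \<bar>d - e\<bar>" "\<bar>Q d r\<bar> \<le> C * \<bar>d - e\<bar>"
    if e: "G e = 0" and r: "r \<in> {R1..R2}" for d e r
  proof -
    have "radial_flow n R1 R2 \<Phi> G (\<lambda>_. e) (\<lambda>_. 0)" by (simp add: radial_flow_def e \<Phi>0)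
    from dep[OF fl[of d] this r] show "\<bar>U d r - e\<bar> \<le> C * \<bar>d - e\<bar>" "\<bar>Q d r\<bar> \<le> C * \<bar>d - e\<bar>"
      by (auto simp: Ud)
  qed
  have ne: "U d r \<noteq> e \<or> Q d r \<noteq> 0" if e: "G e = 0" and d: "d \<noteq> e" and r: "r \<in> {R1..R2}" for d e r
    using radial_flow_avoids_equilibrium[OF fl[of d] R(1), of K L e r] KL K[of _ 0] L[of _ e] r d
    by (auto simp: e \<Phi>0 Ud)
  have pc: "planar_curve R1 R2 (\<lambda>r. U d r - s0) (\<lambda>r. r ^ n * Q d r) (\<lambda>r. \<Phi> (Q d r)) (\<lambda>r. - (r ^ n * G (U d r)))"
    if "d \<noteq> s0" for d
    by (rule flow_planar_curve[OF fl R \<Phi>c Gc ne[OF G0(2) that]])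
  define \<Theta> where "\<Theta> d = flow_angle n R1 \<Phi> G s0 (U d) (Q d) R2" for d
  have \<Theta>c: "continuous_on {d. d \<noteq> s0} \<Theta>"
    unfolding \<Theta>_def by (rule flow_angle_continuous[OF fl R lip \<Phi>c Gc]) (use ne[OF G0(2)] in auto)
  have \<Theta>small: "\<Theta> d < pi / 2" if "\<And>r. r \<in> {R1..R2} \<Longrightarrow> U d r \<noteq> s0" for d
  proof -
    have "d \<noteq> s0" using that[of R1] R Ud by auto
    then show ?thesis unfolding \<Theta>_def by (intro flow_angle_small[OF pc] that) auto
  qed
  have \<Phi>bd: "\<bar>\<Phi> x\<bar> \<le> 1" for x
    using minkowski_slope_bound[of "x / a"] by (simp add: \<Phi>_def)
  have speed: "\<bar>U d r - d\<bar> \<le> R2 - R1" if "r \<in> {R1..R2}" for d r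
    using radial_flow_speed_bound[OF fl \<Phi>bd that, of d] by (simp add: Ud)

  have solution: "\<exists>v p. radial_solution n R1 R2 f v p \<and> v R1 = d \<and> card {r\<in>{R1<..<R2}. v r - s0 = 0} = j"
    if d: "0 < d" "d \<le> dM" "d \<noteq> s0" and ang: "\<Theta> d = real j * pi" for d
  proof -
    have R2I: "R2 \<in> {R1..R2}" using R by simp
    obtain b where "R2 ^ n * Q d R2 = - ((U d R1 - s0) * b * sin (\<Theta> d))"
      unfolding \<Theta>_def by (rule planar_curve_polar[OF pc[OF d(3)] R2I, folded flow_angle_def])
    then have q2: "Q d R2 = 0" using R by (simp add: ang)
    have pos: "0 < U d r" if "r \<in> {R1..R2}" for r
      by (rule flow_positive[OF fl R \<Phi>sgn _ ne[OF G0(1)] _ q2 that]) (use d fc_neg in \<open>auto simp: G_def Ud\<close>)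
    have inM: "U d r \<le> M" if "r \<in> {R1..R2}" for r
      using speed[OF that, of d] d by (auto simp: M_def)
    have "radial_flow n R1 R2 (\<lambda>x. minkowski_slope (x / a)) (\<lambda>s. a * fc s) (U d) (Q d)"
      using fl[of d] by (simp add: \<Phi>_def[abs_def] G_def[abs_def])
    then have "radial_flow n R1 R2 minkowski_slope f (U d) (\<lambda>r. Q d r / a)"
    proof (rule radial_flow_rescale)
      show "fc (U d r) = f (U d r)" if "r \<in> {R1..R2}" for r
        using pos[OF that] inM[OF that] by (intro fc_eq) auto
    qed (use a in simp)
    then have "radial_solution n R1 R2 f (U d) (\<lambda>r. Q d r / a)"
      using q2 pos by (simp add: radial_solution_def)
    moreover have "card {r\<in>{R1<..<R2}. U d r - s0 = 0} = j"
    proof (rule card_flow_zeros[OF R pc[OF d(3)] \<Phi>sgn])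
      fix r assume r: "r \<in> {R1..R2}" "U d r \<noteq> s0"
      have "0 < (U d r - s0) * f (U d r)"
        using f_neg[of "U d r"] f_pos[of "U d r"] pos[OF r(1)] r(2)
        by (cases "U d r < s0") (auto simp: zero_less_mult_iff)
      then have "0 < a * ((U d r - s0) * f (U d r))" using a by simp
      then show "0 < (U d r - s0) * G (U d r)"
        using pos[OF r(1)] inM[OF r(1)] by (simp add: G_def fc_eq mult_ac)
    qed (use ang in \<open>simp_all add: \<Theta>_def\<close>)
    ultimately show ?thesis using Ud by blast
  qed

  obtain \<eta> where \<eta>: "0 < \<eta>" "\<And>d. d \<noteq> s0 \<Longrightarrow> \<bar>d - s0\<bar> < \<eta> \<Longrightarrow> real j * pi < \<Theta> d"
  proof -
    have "(f has_real_derivative f' s0) (at s0 within {0<..})"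
      by (rule DERIV_subset[OF f_deriv]) (use s0 in auto)
    then have "(f has_real_derivative f' s0) (at s0)" using s0 by (simp add: at_within_open[of _ "{0<..}"])
    then have "((\<lambda>s. (f s - f s0) / (s - s0)) \<longlongrightarrow> f' s0) (at s0)" by (simp add: has_field_derivative_iff)
    then have "\<forall>\<^sub>F s in at s0. c1 < (f s - f s0) / (s - s0)" using c1(2) by (rule order_tendstoD)
    then obtain \<delta>1 where \<delta>1: "0 < \<delta>1" "\<And>s. s \<noteq> s0 \<Longrightarrow> \<bar>s - s0\<bar> < \<delta>1 \<Longrightarrow> c1 < f s / (s - s0)"
      unfolding eventually_at by (auto simp: dist_real_def f_zeros)
    \<comment> \<open>Below sqrt(1 - a^2) the flux satisfies q^2 \<le> q \<Phi>(q); the bounds s0 and M - s0 keep u where fc = f.\<close>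
    define \<delta> where "\<delta> = Min {\<delta>1, s0, M - s0, sqrt (1 - a\<^sup>2)}"
    have a2: "a\<^sup>2 < 1" using a by (simp add: power_less_one_iff)
    have \<delta>: "0 < \<delta>" "\<delta> \<le> \<delta>1" "\<delta> \<le> s0" "\<delta> \<le> M - s0" "\<delta> \<le> sqrt (1 - a\<^sup>2)"
      using \<delta>1(1) s0 M a2 by (auto simp: \<delta>_def)
    show ?thesis
    proof (rule that[of "\<delta> / C"])
      show "0 < \<delta> / C" using \<delta> C by simp
      fix d assume d: "d \<noteq> s0" "\<bar>d - s0\<bar> < \<delta> / C"
      then have Cd: "C * \<bar>d - s0\<bar> < \<delta>" using C by (simp add: field_simps)
      have "real m * pi < flow_angle n R1 \<Phi> G s0 (U d) (Q d) R2"
      proof (rule flow_angle_gt_eigen_angle[OF eh R lam(1) a(3) pc[OF d(1)]])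
        fix r assume "R1 < r" "r < R2"
        then have r: "r \<in> {R1..R2}" by simp
        have bu: "\<bar>U d r - s0\<bar> < \<delta>" and bq: "\<bar>Q d r\<bar> < sqrt (1 - a\<^sup>2)"
          using near_eq[OF G0(2) r, of d] Cd \<delta>(5) by linarith+
        have "(Q d r)\<^sup>2 \<le> 1 - a\<^sup>2"
          using power_mono[of "\<bar>Q d r\<bar>" "sqrt (1 - a\<^sup>2)" 2] bq a2 by simp
        then have "sqrt (a\<^sup>2 + (Q d r)\<^sup>2) \<le> 1" by simp
        moreover have "a * sqrt (1 + (Q d r / a)\<^sup>2) = sqrt (a\<^sup>2 + (Q d r)\<^sup>2)"
        proof -
          have "a\<^sup>2 + (Q d r)\<^sup>2 = a\<^sup>2 * (1 + (Q d r / a)\<^sup>2)" using a by (simp add: field_simps)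
          then show ?thesis using a by (simp add: real_sqrt_mult)
        qed
        ultimately have le1: "a * sqrt (1 + (Q d r / a)\<^sup>2) \<le> 1" by simp
        have "(Q d r)\<^sup>2 / 1 \<le> (Q d r)\<^sup>2 / (a * sqrt (1 + (Q d r / a)\<^sup>2))"
          using a by (intro divide_left_mono[OF le1]) (auto intro!: mult_pos_pos simp: add_pos_nonneg)
        then show "(Q d r)\<^sup>2 \<le> Q d r * \<Phi> (Q d r)"
          by (simp add: \<Phi>_def minkowski_slope_def power2_eq_square)
        show "a * c1 * (U d r - s0)\<^sup>2 \<le> (U d r - s0) * G (U d r)"
        proof (cases "U d r = s0")
          case False
          then have "c1 < f (U d r) / (U d r - s0)" using \<delta>1(2) bu \<delta>(2) by auto
          then have "c1 * (U d r - s0)\<^sup>2 \<le> f (U d r) / (U d r - s0) * (U d r - s0)\<^sup>2"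
            by (intro mult_right_mono) auto
          also have "\<dots> = (U d r - s0) * f (U d r)" using False by (simp add: power2_eq_square)
          finally have "a * (c1 * (U d r - s0)\<^sup>2) \<le> a * ((U d r - s0) * f (U d r))"
            using a by (intro mult_left_mono) auto
          moreover have "fc (U d r) = f (U d r)" using bu \<delta> by (intro fc_eq) linarith+
          ultimately show ?thesis by (simp add: G_def mult_ac)
        qed simp
      qed
      moreover have "real j * pi \<le> real m * pi" using j by (intro mult_right_mono) auto
      ultimately show "real j * pi < \<Theta> d" unfolding \<Theta>_def by linarith
    qed
  qed
  have half: "pi / 2 < real j * pi"
  proof -
    have "1 * pi \<le> real j * pi" using j by (intro mult_right_mono) auto
    then show ?thesis using pi_gt_zero by linarith
  qed

  show "\<exists>v p. radial_solution n R1 R2 f v p \<and> v R1 < s0 \<and> card {r\<in>{R1<..<R2}. v r - s0 = 0} = j"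
  proof -
    define d0 where "d0 = s0 / (2 * C)"
    define d1 where "d1 = max d0 (s0 - \<eta> / 2)"
    have d0: "0 < d0" "C * d0 = s0 / 2" "d0 < s0" using s0 C by (auto simp: d0_def field_simps)
    have d1: "d0 \<le> d1" "d1 < s0" "\<bar>d1 - s0\<bar> < \<eta>" using d0 \<eta>(1) by (auto simp: d1_def max_def)
    have "\<Theta> d0 < pi / 2"
    proof (rule \<Theta>small)
      fix r assume "r \<in> {R1..R2}"
      from near_eq(1)[OF G0(1) this, of d0] have "\<bar>U d0 r\<bar> \<le> s0 / 2" using d0 by simp
      then show "U d0 r \<noteq> s0" using s0 by auto
    qed
    moreover have "real j * pi < \<Theta> d1" using \<eta>(2)[of d1] d1 by auto
    moreover have "continuous_on {d0..d1} \<Theta>" by (rule continuous_on_subset[OF \<Theta>c]) (use d1 in auto)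
    ultimately obtain d where d: "d0 \<le> d" "d \<le> d1" "\<Theta> d = real j * pi"
      using IVT'[of \<Theta> d0 "real j * pi" d1] half d1 by auto
    then obtain v p where "radial_solution n R1 R2 f v p" "v R1 = d" "card {r\<in>{R1<..<R2}. v r - s0 = 0} = j"
      using solution[of d] d0 d1 M by auto
    then show ?thesis using d d1 by auto
  qed
  show "\<exists>v p. radial_solution n R1 R2 f v p \<and> s0 < v R1 \<and> card {r\<in>{R1<..<R2}. v r - s0 = 0} = j"
  proof -
    define d1 where "d1 = min dM (s0 + \<eta> / 2)"
    have d1: "d1 \<le> dM" "s0 < d1" "\<bar>d1 - s0\<bar> < \<eta>" using M \<eta>(1) by (auto simp: d1_def min_def)
    have "\<Theta> dM < pi / 2"
    proof (rule \<Theta>small)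
      fix r assume "r \<in> {R1..R2}"
      from speed[OF this, of dM] show "U dM r \<noteq> s0" by (auto simp: dM_def)
    qed
    moreover have "real j * pi < \<Theta> d1" using \<eta>(2)[of d1] d1 by auto
    moreover have "continuous_on {d1..dM} \<Theta>" by (rule continuous_on_subset[OF \<Theta>c]) (use d1 in auto)
    ultimately obtain d where d: "d1 \<le> d" "d \<le> dM" "\<Theta> d = real j * pi"
      using IVT2'[of \<Theta> dM "real j * pi" d1] half d1 by auto
    then obtain v p where "radial_solution n R1 R2 f v p" "v R1 = d" "card {r\<in>{R1<..<R2}. v r - s0 = 0} = j"
      using solution[of d] d1 s0 by auto
    then show ?thesis using d d1 by auto
  qed
qed

lemma neumann_solution_of_radial_solution:
  fixes \<Omega> :: "'a::euclidean_space set"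
  assumes dom: "radial_domain R1 R2 \<Omega>" and sol: "radial_solution (DIM('a) - 1) R1 R2 f v p"
    and f: "continuous_on {0..} f"
  shows "neumann_solution \<Omega> (outer_normal R1) f (\<lambda>x. v (norm x))"
proof -
  have R: "0 \<le> R1" "R1 < R2" using dom by (auto simp: radial_domain_def)
  have fl: "radial_flow (DIM('a) - 1) R1 R2 minkowski_slope f v p" and p2: "p R2 = 0"
    and pos: "\<And>r. r \<in> {R1..R2} \<Longrightarrow> 0 < v r"
    using sol by (auto simp: radial_solution_def)
  have fv: "continuous_on {R1..R2} (\<lambda>r. f (v r))"
    by (rule continuous_on_compose2[OF f radial_flow_u_cont[OF fl]]) (use pos in \<open>auto intro: less_imp_le\<close>)
  show ?thesis
  proof (rule neumann_solution_of_radial[OF dom, where v = v and p = p and f = f])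
    fix r assume "r \<in> {R1<..<R2}"
    then show "(p has_real_derivative - f (v r) - real (DIM('a) - 1) / r * p r) (at r)"
      by (rule radial_flow_q_deriv[OF fl R(1)])
  next
    assume "R1 = 0"
    then have "(p has_real_derivative - f (v 0) / real (DIM('a) - 1 + 1)) (at 0 within {0..R2})"
      using fl R fv by (intro radial_flow_deriv_origin[of _ _ minkowski_slope]) auto
    then show "(p has_real_derivative - f (v 0) / DIM('a)) (at 0 within {0..R2})"
      by (simp only: le_add_diff_inverse2 DIM_positive Suc_leI One_nat_def)
  qed (use fl p2 fv pos in \<open>auto simp: radial_flow_def\<close>)
qed

section \<open>Existence of the 2k solutions\<close>

theorem theorem1p1:
  fixes \<Omega> :: "'a::euclidean_space set"
    and R1 R2 s0 lam :: real
    and f f' :: "real \<Rightarrow> real"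
    and k :: nat
  assumes domain:
      "(0 < R1 \<and> R1 < R2 \<and> \<Omega> = {x. R1 < norm x \<and> norm x < R2}) \<or>
       (R1 = 0 \<and> 0 < R2 \<and> \<Omega> = {x. norm x < R2})"
    and s0: "s0 > 0"
    and f_deriv: "\<And>s. s \<ge> 0 \<Longrightarrow> (f has_real_derivative f' s) (at s within {0..})"
    and f'_cont: "continuous_on {0..} f'"
    and f_zeros: "f 0 = 0" "f s0 = 0"
    and f_neg: "\<And>s. 0 < s \<Longrightarrow> s < s0 \<Longrightarrow> f s < 0"
    and f_pos: "\<And>s. s > s0 \<Longrightarrow> f s > 0"
    and k: "k \<ge> 1"
    and lam: "is_kth_radial_neumann_eigenvalue DIM('a) R1 R2 (k + 1) lam"
    and f'_s0: "f' s0 > lam"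
  shows "\<exists>(u :: nat \<Rightarrow> 'a \<Rightarrow> real) (v :: nat \<Rightarrow> real \<Rightarrow> real).
      (\<forall>j\<in>{1..2*k}.
          neumann_solution \<Omega> (outer_normal R1) f (u j) \<and>
          (\<forall>x\<in>closure \<Omega>. u j x = v j (norm x)) \<and>
          \<not> u j constant_on \<Omega>) \<and>
      (\<forall>i\<in>{1..2*k}. \<forall>j\<in>{1..2*k}. i \<noteq> j \<longrightarrow> (\<exists>x\<in>\<Omega>. u i x \<noteq> u j x)) \<and>
      (\<forall>j\<in>{1..k}. v j R1 < s0) \<and>
      (\<forall>j\<in>{k+1..2*k}. v j R1 > s0) \<and>
      (\<forall>j\<in>{1..k}. card {r\<in>{R1<..<R2}. v j r - s0 = 0} = j \<and>
                      card {r\<in>{R1<..<R2}. v (j + k) r - s0 = 0} = j)"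
proof -
  let ?n = "DIM('a) - 1"
  have dom: "radial_domain R1 R2 \<Omega>" using domain by (simp add: radial_domain_def)
  have R: "0 \<le> R1" "R1 < R2" using domain by auto
  have f_cont: "continuous_on {0..} f" using f_deriv by (intro DERIV_continuous_on) auto
  obtain m where m: "eigen_half_turns ?n R1 R2 lam m" "k \<le> m"
    by (rule kth_eigenvalue_half_turns[OF lam R])
  have "radial_neumann_eigenvalue DIM('a) R1 R2 lam"
    using lam unfolding is_kth_radial_neumann_eigenvalue_def by blast
  then have lam0: "0 \<le> lam" by (rule eigenvalue_nonneg[OF _ R])
  note ex = radial_solutions_exist[OF R s0 f_deriv f'_cont f_zeros f_neg f_pos m(1) lam0 f'_s0]
  let ?zeros = "\<lambda>v. card {r\<in>{R1<..<R2}. v r - s0 = 0}"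
  have "\<forall>j. \<exists>v. j \<in> {1..k} \<longrightarrow> (\<exists>p. radial_solution ?n R1 R2 f v p) \<and> v R1 < s0 \<and> ?zeros v = j"
    using ex(1) m(2) by fastforce
  then obtain vb where vb: "\<And>j. j \<in> {1..k} \<Longrightarrow>
      (\<exists>p. radial_solution ?n R1 R2 f (vb j) p) \<and> vb j R1 < s0 \<and> ?zeros (vb j) = j"
    by metis
  have "\<forall>j. \<exists>v. j \<in> {1..k} \<longrightarrow> (\<exists>p. radial_solution ?n R1 R2 f v p) \<and> s0 < v R1 \<and> ?zeros v = j"
    using ex(2) m(2) by fastforce
  then obtain va where va: "\<And>j. j \<in> {1..k} \<Longrightarrow>
      (\<exists>p. radial_solution ?n R1 R2 f (va j) p) \<and> s0 < va j R1 \<and> ?zeros (va j) = j"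
    by metis
  define v where "v i = (if i \<le> k then vb i else va (i - k))" for i
  define u where "u i x = v i (norm x)" for i and x :: 'a
  have sol: "\<exists>p. radial_solution ?n R1 R2 f (v i) p" if "i \<in> {1..2*k}" for i
  proof (cases "i \<le> k")
    case True
    then show ?thesis using vb[of i] that by (simp add: v_def)
  next
    case False
    then have "i - k \<in> {1..k}" using that by auto
    from va[OF this] False show ?thesis by (simp add: v_def)
  qed
  have cont: "continuous_on {R1..R2} (v i)" if "i \<in> {1..2*k}" for i
    using sol[OF that] radial_flow_u_cont by (auto simp: radial_solution_def)
  have low: "v j R1 < s0" "?zeros (v j) = j" if "j \<in> {1..k}" for j
    using vb[OF that] that by (auto simp: v_def)
  have high: "s0 < v (j + k) R1" "?zeros (v (j + k)) = j" if "j \<in> {1..k}" for j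
    using va[OF that] that by (auto simp: v_def)
  have high': "s0 < v j R1" if "j \<in> {k+1..2*k}" for j
  proof -
    have "j - k \<in> {1..k}" "j - k + k = j" using that by auto
    then show ?thesis using high(1)[of "j - k"] by simp
  qed
  have sphere: "\<exists>x\<in>\<Omega>. norm x = r" if "r \<in> {R1<..<R2}" for r
  proof -
    have "0 \<le> r" using that R by auto
    then obtain x :: 'a where "norm x = r" by (rule vector_choose_size)
    then show ?thesis using domain that by (intro bexI[of _ x]) auto
  qed
  \<comment> \<open>Information on the open interval determines the values at R1.\<close>
  have start: "g R1 = h R1"
    if g: "continuous_on {R1..R2} g" and h: "continuous_on {R1..R2} h"
      and eq: "\<And>r. r \<in> {R1<..<R2} \<Longrightarrow> g r = h r" for g h :: "real \<Rightarrow> real"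
  proof -
    have cl: "closure {R1<..<R2} = {R1..R2}" using R by (simp add: closure_greaterThanLessThan)
    have "continuous_on (closure {R1<..<R2}) (\<lambda>r. g r - h r)" unfolding cl by (intro continuous_intros g h)
    then have "g R1 - h R1 = 0"
      by (rule continuous_constant_on_closure) (use eq cl R in auto)
    then show ?thesis by simp
  qed
  \<comment> \<open>The value at R1 tells the two families apart, and the number of zeros the members of one family.\<close>
  have distinct: "\<exists>x\<in>\<Omega>. u i x \<noteq> u j x" if ij: "i \<in> {1..2*k}" "j \<in> {1..2*k}" "i \<noteq> j" for i j
  proof (rule ccontr)
    assume "\<not> ?thesis"
    then have eq: "v i r = v j r" if "r \<in> {R1<..<R2}" for r
      using sphere[OF that] by (auto simp: u_def)
    have R1eq: "v i R1 = v j R1" by (rule start[OF cont[OF ij(1)] cont[OF ij(2)] eq])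
    have "{r\<in>{R1<..<R2}. v i r - s0 = 0} = {r\<in>{R1<..<R2}. v j r - s0 = 0}" using eq by auto
    then have zeq: "?zeros (v i) = ?zeros (v j)" by simp
    show False
    proof (cases "i \<le> k")
      case True
      then have "i \<in> {1..k}" using ij by auto
      then have "j \<in> {1..k}" using low(1)[of i] high'[of j] R1eq ij by (cases "j \<le> k") auto
      then show False using low(2)[of i] low(2)[of j] zeq ij \<open>i \<in> {1..k}\<close> by simp
    next
      case False
      then have ik: "i - k \<in> {1..k}" "i - k + k = i" using ij by auto
      then have "\<not> j \<le> k" using high(1)[OF ik(1)] low(1)[of j] R1eq ij by auto
      then have jk: "j - k \<in> {1..k}" "j - k + k = j" using ij by auto
      show False using high(2)[OF ik(1)] high(2)[OF jk(1)] zeq ij ik jk by simp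
    qed
  qed
  have nonconst: "\<not> u i constant_on \<Omega>" if i: "i \<in> {1..2*k}" for i
  proof
    assume "u i constant_on \<Omega>"
    then obtain c where c: "\<And>x. x \<in> \<Omega> \<Longrightarrow> u i x = c" by (auto simp: constant_on_def)
    have eq: "v i r = c" if "r \<in> {R1<..<R2}" for r
      using sphere[OF that] c by (auto simp: u_def)
    have R1c: "v i R1 = c" by (rule start[OF cont[OF i] continuous_on_const eq])
    have nz: "?zeros (v i) \<noteq> 0 \<and> v i R1 \<noteq> s0"
    proof (cases "i \<le> k")
      case True
      then show ?thesis using low[of i] i by auto
    next
      case False
      then have "i - k \<in> {1..k}" "i - k + k = i" using i by auto
      then show ?thesis using high[of "i - k"] by simp
    qed
    then have "{r\<in>{R1<..<R2}. v i r - s0 = 0} \<noteq> {}" by (metis card.empty)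
    then show False using eq R1c nz by auto
  qed
  show ?thesis
  proof (intro exI[of _ u] exI[of _ v] conjI ballI impI)
    fix i assume i: "i \<in> {1..2*k}"
    obtain p where "radial_solution ?n R1 R2 f (v i) p" using sol[OF i] by blast
    then show "neumann_solution \<Omega> (outer_normal R1) f (u i)"
      unfolding u_def by (rule neumann_solution_of_radial_solution[OF dom _ f_cont])
  qed (use nonconst distinct low high high' in \<open>auto simp: u_def\<close>)
qed

end
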